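(* For an Ascoli space $X$ the following are equivalent: (i) the free locally convex space $L(X)$ has a $\mathfrak{G}$-base; (ii) $C_k(X)$ has a fundamental compact resolution; (iii) $C_k(C_k(X))$ has a $\mathfrak{G}$-base. In particular, each of these conditions implies that every compact subset of $X$ is metrizable.
   Context: $C_k(Y)$ is the space of continuous real-valued functions on a Tychonoff space $Y$ with the compact-open topology. $X$ is an Ascoli space if every compact subset of $C_k(X)$ is equicontinuous. The free locally convex space $L(X)$ over $X$ is the locally convex space together with a continuous map $i:X\to L(X)$ such that every continuous map $f$ from $X$ into a locally convex space $F$ extends uniquely to a continuous linear operator $\bar f:L(X)\to F$ with $f=\bar f\circ i$ ($X$ is a Hamel basis of $L(X)$ and $i$ is an embedding). Order $\mathbb{N}^{\mathbb{N}}$ pointwise. A $\mathfrak{G}$-base is a base of neighbourhoods of zero $\{U_\alpha:\alpha\in\mathbb{N}^{\mathbb{N}}\}$ with $U_\alpha\subseteq U_\beta$ whenever $\beta\le\alpha$. A fundamental compact resolution of a space $Z$ is a family $\{K_\alpha:\alpha\in\mathbb{N}^{\mathbb{N}}\}$ of compact sets covering $Z$ with $K_\alpha\subseteq K_\beta$ for $\alpha\le\beta$ such that every compact subset of $Z$ lies in some $K_\alpha$. *)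

theory Defs
  imports "HOL-Analysis.Analysis"
begin

text \<open>Elements of C_k(X) are the continuous real functions on topspace X,
  normalised to be 0 outside topspace X (so that each continuous map is
  represented by exactly one HOL function).\<close>

definition Ck_carrier :: "'a topology \<Rightarrow> ('a \<Rightarrow> real) set" where
  "Ck_carrier X = {f. continuous_map X euclideanreal f \<and> (\<forall>x. x \<notin> topspace X \<longrightarrow> f x = 0)}"

definition Ck :: "'a topology \<Rightarrow> ('a \<Rightarrow> real) topology" where
  "Ck X = topology_generated_by
      {{f \<in> Ck_carrier X. f ` K \<subseteq> U} | K U. compactin X K \<and> open U}"

definition equicontinuous_on :: "'a topology \<Rightarrow> ('a \<Rightarrow> real) set \<Rightarrow> bool" where
  "equicontinuous_on X F \<longleftrightarrow>
     (\<forall>x \<in> topspace X. \<forall>e > 0. \<exists>W. openin X W \<and> x \<in> W \<and>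
        (\<forall>f \<in> F. \<forall>y \<in> W. \<bar>f y - f x\<bar> < e))"

definition ascoli_space :: "'a topology \<Rightarrow> bool" where
  "ascoli_space X \<longleftrightarrow> (\<forall>K. compactin (Ck X) K \<longrightarrow> equicontinuous_on X K)"

definition nhd_in :: "'b topology \<Rightarrow> 'b \<Rightarrow> 'b set \<Rightarrow> bool" where
  "nhd_in Z z N \<longleftrightarrow> N \<subseteq> topspace Z \<and> (\<exists>V. openin Z V \<and> z \<in> V \<and> V \<subseteq> N)"

definition G_base :: "'b topology \<Rightarrow> 'b \<Rightarrow> bool" where
  "G_base Z z \<longleftrightarrow> (\<exists>U :: (nat \<Rightarrow> nat) \<Rightarrow> 'b set.
      (\<forall>\<alpha>. nhd_in Z z (U \<alpha>)) \<and>
      (\<forall>\<alpha> \<beta>. \<beta> \<le> \<alpha> \<longrightarrow> U \<alpha> \<subseteq> U \<beta>) \<and>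
      (\<forall>N. nhd_in Z z N \<longrightarrow> (\<exists>\<alpha>. U \<alpha> \<subseteq> N)))"

definition fundamental_compact_resolution :: "'b topology \<Rightarrow> bool" where
  "fundamental_compact_resolution Z \<longleftrightarrow> (\<exists>K :: (nat \<Rightarrow> nat) \<Rightarrow> 'b set.
      (\<forall>\<alpha>. compactin Z (K \<alpha>)) \<and>
      (\<Union>\<alpha>. K \<alpha>) = topspace Z \<and>
      (\<forall>\<alpha> \<beta>. \<alpha> \<le> \<beta> \<longrightarrow> K \<alpha> \<subseteq> K \<beta>) \<and>
      (\<forall>C. compactin Z C \<longrightarrow> (\<exists>\<alpha>. C \<subseteq> K \<alpha>)))"

text \<open>Underlying vector space: formal finite real linear combinations of points
  of X, i.e. finitely supported functions topspace X \<rightarrow> real; the canonical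
  map i sends x to the point mass at x.\<close>

definition L_carrier :: "'a topology \<Rightarrow> ('a \<Rightarrow> real) set" where
  "L_carrier X = {f. finite {y. f y \<noteq> 0} \<and> {y. f y \<noteq> 0} \<subseteq> topspace X}"

definition L_delta :: "'a \<Rightarrow> ('a \<Rightarrow> real)" where
  "L_delta x = (\<lambda>y. if y = x then 1 else 0)"

definition lc_vector_topology :: "('a \<Rightarrow> real) set \<Rightarrow> ('a \<Rightarrow> real) topology \<Rightarrow> bool" where
  "lc_vector_topology V T \<longleftrightarrow>
     topspace T = V \<and>
     continuous_map (prod_topology T T) T (\<lambda>(u, v). (\<lambda>y. u y + v y)) \<and>
     continuous_map (prod_topology euclideanreal T) T (\<lambda>(c, v). (\<lambda>y. c * v y)) \<and>
     (\<forall>N. nhd_in T (\<lambda>_. 0) N \<longrightarrow>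
        (\<exists>C. openin T C \<and> (\<lambda>_. 0) \<in> C \<and> C \<subseteq> N \<and>
             (\<forall>u \<in> C. \<forall>v \<in> C. \<forall>t::real. 0 \<le> t \<and> t \<le> 1 \<longrightarrow>
                 (\<lambda>y. t * u y + (1 - t) * v y) \<in> C)))"

text \<open>L(X) carries the finest locally convex vector topology on L_carrier X
  for which i = L_delta is continuous (this is exactly the topology given by
  the universal property).  It is the topology generated by the union of all
  such topologies.\<close>

definition Lfree :: "'a topology \<Rightarrow> ('a \<Rightarrow> real) topology" where
  "Lfree X = topology_generated_by
      (\<Union>{{U. openin T U} | T. lc_vector_topology (L_carrier X) T \<and>
                              continuous_map X T L_delta})"

end

theory Submission
  imports Defs
begin

text \<open>By the Hahn-Banach theorem, every neighbourhood of zero in L(X) contains the polar of a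
  pointwise bounded equicontinuous set of functions, and all such polars are neighbourhoods of zero.
  By Arzela-Ascoli these sets are relatively compact in C_k(X), and for an Ascoli space every
  compact subset of C_k(X) is of this kind. So polarity exchanges the \<open>\<GG>\<close>-bases of L(X) and the
  fundamental compact resolutions of C_k(X). The same exchange works for C_k(C_k(X)), because
  points of C_k(X) can be separated from compact sets by continuous functions.

  For metrizability, restrict C_k(X) to a compact \<open>K\<close>. Given a compact resolution, a uniformly
  separated family in C(K) is a monotone union of finite sets indexed by \<open>\<nat>\<^sup>\<nat>\<close>, hence
  countable by a diagonal argument. So countably many continuous functions separate the points of
  \<open>K\<close>.\<close>

section \<open>Hahn-Banach for sublinear functionals\<close>

text \<open>The dual of L(X) is handled without dual spaces. A linear functional on finitely
  supported functions is determined by its values at point masses, so it is a function on X paired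
  with vectors by \<open>pairing\<close>. Domination by a seminorm then makes this function
  continuous, because the seminorm of a difference of point masses controls the difference of its
  values. The Ascoli property enters at one point, common to both directions between (i) and (ii):
  it makes the polar of a compact set of functions a neighbourhood of zero in L(X). The converse
  passage, from a neighbourhood to a compact set, rests on Hahn-Banach and Arzela-Ascoli. Polars are
  defined by weak bounds, which keeps them closed, whereas open balls are given by strict ones. The
  factors 2 and the halved radii that recur bridge this gap. For C_k(C_k(X)) a neighbourhood has a
  compact set and a radius as data, and a single index in \<open>\<nat>\<^sup>\<nat>\<close> has to
  encode both. For metrizability no dense set of functions is required: approximation on the compact
  set up to 1/2 already separates points.\<close>

definition function_subspace :: "('a \<Rightarrow> real) set \<Rightarrow> bool" where
  "function_subspace V \<longleftrightarrow> (\<lambda>_. 0) \<in> V \<and> (\<forall>u\<in>V. \<forall>v\<in>V. (\<lambda>y. u y + v y) \<in> V) \<and>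
     (\<forall>c. \<forall>u\<in>V. (\<lambda>y. c * u y) \<in> V)"

text \<open>Homogeneity is asked as an inequality because infima of sublinear functionals inherit it
  in this form. Equality is recovered in \<open>sublinear_on_scale\<close> by scaling back with
  \<open>inverse c\<close>.\<close>

definition sublinear_on :: "('a \<Rightarrow> real) set \<Rightarrow> (('a \<Rightarrow> real) \<Rightarrow> real) \<Rightarrow> bool" where
  "sublinear_on V q \<longleftrightarrow> (\<forall>u\<in>V. \<forall>v\<in>V. q (\<lambda>y. u y + v y) \<le> q u + q v) \<and>
     (\<forall>c\<ge>0. \<forall>u\<in>V. q (\<lambda>y. c * u y) \<le> c * q u)"

lemma function_subspaceD:
  assumes "function_subspace V"
  shows "(\<lambda>_. 0) \<in> V" "\<And>u v. u \<in> V \<Longrightarrow> v \<in> V \<Longrightarrow> (\<lambda>y. u y + v y) \<in> V"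
    "\<And>c u. u \<in> V \<Longrightarrow> (\<lambda>y. c * u y) \<in> V" "\<And>u. u \<in> V \<Longrightarrow> (\<lambda>y. - u y) \<in> V"
    "\<And>u v. u \<in> V \<Longrightarrow> v \<in> V \<Longrightarrow> (\<lambda>y. u y - v y) \<in> V"
proof -
  show "(\<lambda>_. 0) \<in> V" and add: "\<And>u v. u \<in> V \<Longrightarrow> v \<in> V \<Longrightarrow> (\<lambda>y. u y + v y) \<in> V"
    and scale: "\<And>c u. u \<in> V \<Longrightarrow> (\<lambda>y. c * u y) \<in> V"
    using assms by (auto simp: function_subspace_def)
  show neg: "(\<lambda>y. - u y) \<in> V" if "u \<in> V" for u
    using scale[OF that, of "-1"] by simp
  show "(\<lambda>y. u y - v y) \<in> V" if "u \<in> V" "v \<in> V" for u v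
    using add[OF that(1) neg[OF that(2)]] by simp
qed

lemma sublinear_onD:
  assumes "sublinear_on V q"
  shows "\<And>u v. u \<in> V \<Longrightarrow> v \<in> V \<Longrightarrow> q (\<lambda>y. u y + v y) \<le> q u + q v"
    "\<And>c u. u \<in> V \<Longrightarrow> c \<ge> 0 \<Longrightarrow> q (\<lambda>y. c * u y) \<le> c * q u"
  using assms by (auto simp: sublinear_on_def)

lemma sublinear_on_zero:
  assumes V: "function_subspace V" and q: "sublinear_on V q"
  shows "q (\<lambda>_. 0) = 0"
proof -
  note z = function_subspaceD(1)[OF V]
  show ?thesis
    using sublinear_onD(1)[OF q z z] sublinear_onD(2)[OF q z, of 0] by simp
qed

lemma sublinear_on_scale:
  assumes V: "function_subspace V" and q: "sublinear_on V q" and u: "u \<in> V" and c: "c \<ge> 0"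
  shows "q (\<lambda>y. c * u y) = c * q u"
proof (cases "c = 0")
  case True
  then show ?thesis using sublinear_on_zero[OF V q] by simp
next
  case False
  with c have "c > 0" by simp
  have "q u = q (\<lambda>y. inverse c * (c * u y))"
    using \<open>c > 0\<close> by (simp add: field_simps)
  also have "\<dots> \<le> inverse c * q (\<lambda>y. c * u y)"
    using sublinear_onD(2)[OF q function_subspaceD(3)[OF V u], of "inverse c" c] \<open>c > 0\<close> by simp
  finally have "c * q u \<le> q (\<lambda>y. c * u y)"
    using \<open>c > 0\<close> by (simp add: field_simps)
  with sublinear_onD(2)[OF q u c] show ?thesis by simp
qed

lemma sublinear_on_neg:
  assumes V: "function_subspace V" and q: "sublinear_on V q" and u: "u \<in> V"
  shows "- q (\<lambda>y. - u y) \<le> q u"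
  using sublinear_onD(1)[OF q u function_subspaceD(4)[OF V u]] sublinear_on_zero[OF V q] by simp

text \<open>The minorant is the infimum of \<open>q (u + t a) - t q a\<close> over \<open>t \<ge> 0\<close>. It makes minimal
  sublinear functionals additive.\<close>

lemma sublinear_minorant:
  assumes V: "function_subspace V" and q: "sublinear_on V q" and a: "a \<in> V"
  obtains r where "sublinear_on V r" "\<And>u. u \<in> V \<Longrightarrow> r u \<le> q u"
    "\<And>u. u \<in> V \<Longrightarrow> r u \<le> q (\<lambda>y. u y + a y) - q a"
proof -
  define g where "g = (\<lambda>u t. q (\<lambda>y. u y + t * a y) - t * q a)"
  define r where "r = (\<lambda>u. INF t\<in>{0..}. g u t)"
  note D = function_subspaceD[OF V]
  \<comment> \<open>Writing \<open>t a\<close> as \<open>(u + t a) + (- u)\<close> gives a lower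
    bound independent of \<open>t\<close>, so the infimum is a genuine real number.\<close>
  have bdd: "bdd_below (g u ` {0..})" if u: "u \<in> V" for u
  proof (rule bdd_belowI2)
    fix t :: real assume t: "t \<in> {0..}"
    have "t * q a = q (\<lambda>y. t * a y)" using sublinear_on_scale[OF V q a] t by simp
    also have "\<dots> = q (\<lambda>y. (u y + t * a y) + - u y)" by simp
    also have "\<dots> \<le> q (\<lambda>y. u y + t * a y) + q (\<lambda>y. - u y)"
      using u a by (intro sublinear_onD(1)[OF q] D)
    finally show "- q (\<lambda>y. - u y) \<le> g u t" by (simp add: g_def)
  qed
  have le: "r u \<le> g u t" if "u \<in> V" "t \<ge> 0" for u t
    using that bdd[OF that(1)] by (auto simp: r_def intro: cINF_lower)
  have ge: "c \<le> r u" if "u \<in> V" "\<And>t. t \<ge> 0 \<Longrightarrow> c \<le> g u t" for u c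
    using that by (auto simp: r_def intro!: cINF_greatest)
  have "sublinear_on V r"
    unfolding sublinear_on_def
  proof (intro conjI ballI allI impI)
    fix u v assume uv: "u \<in> V" "v \<in> V"
    \<comment> \<open>Independent parameters for \<open>u\<close> and \<open>v\<close> are
      admissible because \<open>s + t\<close> is again a parameter; the two infima are then taken
      one after the other.\<close>
    have *: "r (\<lambda>y. u y + v y) \<le> g u s + g v t" if "s \<ge> 0" "t \<ge> 0" for s t
    proof -
      have "r (\<lambda>y. u y + v y) \<le> g (\<lambda>y. u y + v y) (s + t)"
        using uv that by (intro le D) auto
      also have "q (\<lambda>y. u y + v y + (s + t) * a y) = q (\<lambda>y. (u y + s * a y) + (v y + t * a y))"
        by (simp add: algebra_simps)
      then have "g (\<lambda>y. u y + v y) (s + t) \<le> g u s + g v t"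
        using sublinear_onD(1)[OF q, of "\<lambda>y. u y + s * a y" "\<lambda>y. v y + t * a y"] uv a
        by (simp add: g_def algebra_simps D)
      finally show ?thesis .
    qed
    have "r (\<lambda>y. u y + v y) - g u s \<le> r v" if "s \<ge> 0" for s
      using *[OF that] by (intro ge uv) (simp add: algebra_simps)
    then have "r (\<lambda>y. u y + v y) - r v \<le> r u"
      by (intro ge uv) (simp add: algebra_simps)
    then show "r (\<lambda>y. u y + v y) \<le> r u + r v" by simp
  next
    fix c :: real and u assume c: "c \<ge> 0" and u: "u \<in> V"
    have *: "r (\<lambda>y. c * u y) \<le> c * g u t" if "t \<ge> 0" for t
    proof -
      have "r (\<lambda>y. c * u y) \<le> g (\<lambda>y. c * u y) (c * t)"
        using u c that by (intro le D) auto
      also have "q (\<lambda>y. c * u y + (c * t) * a y) = q (\<lambda>y. c * (u y + t * a y))"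
        by (simp add: algebra_simps)
      then have "g (\<lambda>y. c * u y) (c * t) \<le> c * g u t"
        using sublinear_onD(2)[OF q _ c, of "\<lambda>y. u y + t * a y"] u a
        by (simp add: g_def algebra_simps D)
      finally show ?thesis .
    qed
    show "r (\<lambda>y. c * u y) \<le> c * r u"
    proof (cases "c = 0")
      case True
      then show ?thesis using *[of 0] by simp
    next
      case False
      with c have "c > 0" by simp
      have "r (\<lambda>y. c * u y) / c \<le> r u"
        using * \<open>c > 0\<close> by (intro ge u) (simp add: field_simps)
      then show ?thesis using \<open>c > 0\<close> by (simp add: field_simps)
    qed
  qed
  \<comment> \<open>The parameter 0 gives domination by \<open>q\<close>, the parameter 1 the
    shifted bound.\<close>
  moreover have "r u \<le> q u" if "u \<in> V" for u
    using le[OF that, of 0] by (simp add: g_def)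
  moreover have "r u \<le> q (\<lambda>y. u y + a y) - q a" if "u \<in> V" for u
    using le[OF that, of 1] by (simp add: g_def)
  ultimately show ?thesis
    using that[of r] by simp
qed

text \<open>Zorn's lemma for the reversed pointwise order. A nonempty chain is bounded below by its
  pointwise infimum, which is finite because every member is at least \<open>- p (- u)\<close> at
  \<open>u\<close>.\<close>

lemma minimal_sublinear_exists:
  assumes V: "function_subspace V" and p: "sublinear_on V p"
  obtains q where "sublinear_on V q" "\<And>u. u \<in> V \<Longrightarrow> q u \<le> p u"
    "\<forall>r. sublinear_on V r \<longrightarrow> (\<forall>u\<in>V. r u \<le> q u) \<longrightarrow> (\<forall>u\<in>V. r u = q u)"
proof -
  \<comment> \<open>Values outside \<open>V\<close> are fixed at 0, so that order and equality of
    functions on the whole type reduce to order and equality on \<open>V\<close>.\<close>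
  define S where "S = {q. sublinear_on V q \<and> (\<forall>u\<in>V. q u \<le> p u) \<and> (\<forall>u. u \<notin> V \<longrightarrow> q u = 0)}"
  note D = function_subspaceD[OF V]
  have restrict: "sublinear_on V (\<lambda>u. if u \<in> V then r u else 0)" if "sublinear_on V r" for r
    using that D by (auto simp: sublinear_on_def)
  have "\<exists>m\<in>S. \<forall>a\<in>S. a \<le> m \<longrightarrow> a = m"
  proof (rule predicate_Zorn)
    show "partial_order_on S (relation_of (\<lambda>x y. y \<le> x) S)"
      by (auto simp: partial_order_on_def preorder_on_def refl_on_def trans_def antisym_def
          relation_of_def)
    fix C assume "C \<in> Chains (relation_of (\<lambda>x y. y \<le> x) S)"
    then have CS: "C \<subseteq> S" and chain: "\<And>x y. x \<in> C \<Longrightarrow> y \<in> C \<Longrightarrow> x \<le> y \<or> y \<le> x"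
      by (auto simp: Chains_def relation_of_def)
    show "\<exists>u\<in>S. \<forall>a\<in>C. u \<le> a"
    proof (cases "C = {}")
      case True
      have "(\<lambda>u. if u \<in> V then p u else 0) \<in> S"
        using restrict[OF p] by (simp add: S_def)
      with True show ?thesis by auto
    next
      case False
      define r where "r = (\<lambda>u. if u \<in> V then (INF q\<in>C. q u) else 0)"
      have bdd: "bdd_below ((\<lambda>q. q u) ` C)" if u: "u \<in> V" for u
      proof (rule bdd_belowI2)
        fix q assume "q \<in> C"
        then have q: "sublinear_on V q" "q (\<lambda>y. - u y) \<le> p (\<lambda>y. - u y)"
          using CS u D by (auto simp: S_def)
        show "- p (\<lambda>y. - u y) \<le> q u"
          using sublinear_on_neg[OF V q(1) u] q(2) by simp
      qed
      have le: "r u \<le> q u" if "u \<in> V" "q \<in> C" for u q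
        using that bdd[OF that(1)] by (auto simp: r_def intro: cINF_lower)
      have ge: "c \<le> r u" if "u \<in> V" "\<And>q. q \<in> C \<Longrightarrow> c \<le> q u" for u c
        using that False by (auto simp: r_def intro!: cINF_greatest)
      have "sublinear_on V r"
        unfolding sublinear_on_def
      proof (intro conjI ballI allI impI)
        fix u v assume uv: "u \<in> V" "v \<in> V"
        \<comment> \<open>In a chain some member lies below both \<open>q1\<close> and
          \<open>q2\<close>; this is what makes a pointwise infimum of subadditive functionals
          subadditive.\<close>
        have *: "r (\<lambda>y. u y + v y) \<le> q1 u + q2 v" if q12: "q1 \<in> C" "q2 \<in> C" for q1 q2
        proof -
          obtain q where q: "q \<in> C" "q \<le> q1" "q \<le> q2"
            using chain[OF q12] q12 by blast
          have "r (\<lambda>y. u y + v y) \<le> q (\<lambda>y. u y + v y)" using uv q by (intro le D)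
          also have "\<dots> \<le> q u + q v" using CS q uv by (auto simp: S_def sublinear_on_def)
          also have "\<dots> \<le> q1 u + q2 v" using q by (simp add: le_fun_def add_mono)
          finally show ?thesis .
        qed
        have "r (\<lambda>y. u y + v y) - q1 u \<le> r v" if "q1 \<in> C" for q1
          using *[OF that] by (intro ge uv) (simp add: algebra_simps)
        then have "r (\<lambda>y. u y + v y) - r v \<le> r u"
          by (intro ge uv) (simp add: algebra_simps)
        then show "r (\<lambda>y. u y + v y) \<le> r u + r v" by simp
      next
        fix c :: real and u assume c: "c \<ge> 0" and u: "u \<in> V"
        have *: "r (\<lambda>y. c * u y) \<le> c * q u" if "q \<in> C" for q
        proof -
          have "sublinear_on V q" using CS that by (auto simp: S_def)
          from sublinear_onD(2)[OF this u c] le[OF D(3)[OF u] that] show ?thesis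
            by (rule order_trans[rotated])
        qed
        show "r (\<lambda>y. c * u y) \<le> c * r u"
        proof (cases "c = 0")
          case True
          then show ?thesis using * False by auto
        next
          case False
          with c have "c > 0" by simp
          have "r (\<lambda>y. c * u y) / c \<le> r u"
            using * \<open>c > 0\<close> by (intro ge u) (simp add: field_simps)
          then show ?thesis using \<open>c > 0\<close> by (simp add: field_simps)
        qed
      qed
      moreover have "r u \<le> p u" if "u \<in> V" for u
      proof -
        obtain q where "q \<in> C" using False by blast
        then have "q u \<le> p u" using CS that by (auto simp: S_def)
        with le[OF that \<open>q \<in> C\<close>] show ?thesis by simp
      qed
      ultimately have "r \<in> S" by (simp add: S_def r_def)
      moreover have "r \<le> q" if "q \<in> C" for q
        using le[OF _ that] that CS by (auto simp: le_fun_def S_def r_def)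
      ultimately show ?thesis by blast
    qed
  qed
  then obtain q where q: "q \<in> S" and min: "\<And>r. r \<in> S \<Longrightarrow> r \<le> q \<Longrightarrow> r = q" by blast
  have qp: "q u \<le> p u" if "u \<in> V" for u using q that by (auto simp: S_def)
  show ?thesis
  proof
    show "sublinear_on V q" and "\<And>u. u \<in> V \<Longrightarrow> q u \<le> p u" using q by (auto simp: S_def)
  next
    show "\<forall>r. sublinear_on V r \<longrightarrow> (\<forall>u\<in>V. r u \<le> q u) \<longrightarrow> (\<forall>u\<in>V. r u = q u)"
    proof (intro allI impI ballI)
      fix r u assume r: "sublinear_on V r" and le: "\<forall>u\<in>V. r u \<le> q u" and u: "u \<in> V"
      have "(\<lambda>u. if u \<in> V then r u else 0) \<in> S"
        using restrict[OF r] order_trans[OF bspec[OF le] qp] by (simp add: S_def)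
      moreover have "(\<lambda>u. if u \<in> V then r u else 0) \<le> q"
        using le q by (auto simp: le_fun_def S_def)
      ultimately have "(\<lambda>u. if u \<in> V then r u else 0) = q" by (rule min)
      from fun_cong[OF this, of u] show "r u = q u" using u by simp
    qed
  qed
qed

text \<open>A minimal sublinear functional is additive: by minimality it equals its own minorant in
  direction \<open>v\<close>, and this gives the missing inequality
  \<open>l u + l v \<le> l (u + v)\<close>. To fix the value at \<open>a\<close>, the minimal
  functional is chosen below the minorant \<open>r\<close> of \<open>p\<close> in direction
  \<open>a\<close>, since \<open>r (- a) \<le> p 0 - p a = - p a\<close>.\<close>

theorem hahn_banach_sublinear:
  assumes V: "function_subspace V" and p: "sublinear_on V p" and a: "a \<in> V"
  obtains l where "\<And>u v. u \<in> V \<Longrightarrow> v \<in> V \<Longrightarrow> l (\<lambda>y. u y + v y) = l u + l v"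
    "\<And>c u. u \<in> V \<Longrightarrow> l (\<lambda>y. c * u y) = c * l u"
    "\<And>u. u \<in> V \<Longrightarrow> l u \<le> p u" "l a = p a"
proof -
  note D = function_subspaceD[OF V]
  obtain r where r: "sublinear_on V r" "\<And>u. u \<in> V \<Longrightarrow> r u \<le> p u"
    "\<And>u. u \<in> V \<Longrightarrow> r u \<le> p (\<lambda>y. u y + a y) - p a"
    by (rule sublinear_minorant[OF V p a]) (rule that)
  obtain l where l: "sublinear_on V l" "\<And>u. u \<in> V \<Longrightarrow> l u \<le> r u"
    and min: "\<forall>s. sublinear_on V s \<longrightarrow> (\<forall>u\<in>V. s u \<le> l u) \<longrightarrow> (\<forall>u\<in>V. s u = l u)"
    by (rule minimal_sublinear_exists[OF V r(1)]) (rule that)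
  have add: "l (\<lambda>y. u y + v y) = l u + l v" if uv: "u \<in> V" "v \<in> V" for u v
  proof -
    obtain s where s: "sublinear_on V s" "\<And>u. u \<in> V \<Longrightarrow> s u \<le> l u"
      "\<And>u. u \<in> V \<Longrightarrow> s u \<le> l (\<lambda>y. u y + v y) - l v"
      by (rule sublinear_minorant[OF V l(1) uv(2)]) (rule that)
    have "l u \<le> l (\<lambda>y. u y + v y) - l v"
      using min s(1,2) s(3)[OF uv(1)] uv(1) by metis
    then show ?thesis using sublinear_onD(1)[OF l(1) uv] by simp
  qed
  have neg: "l (\<lambda>y. - u y) = - l u" if "u \<in> V" for u
    using add[OF that D(4)[OF that]] sublinear_on_zero[OF V l(1)] by simp
  have scale: "l (\<lambda>y. c * u y) = c * l u" if "u \<in> V" for c u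
  proof (cases "c \<ge> 0")
    case True
    then show ?thesis using sublinear_on_scale[OF V l(1) that] by simp
  next
    case False
    then show ?thesis
      using sublinear_on_scale[OF V l(1) that, of "- c"] neg[OF D(3)[OF that, of "- c"]] by simp
  qed
  have "l (\<lambda>y. - a y) \<le> - p a"
    using l(2)[OF D(4)[OF a]] r(3)[OF D(4)[OF a]] sublinear_on_zero[OF V p] by simp
  then have "p a \<le> l a" using neg[OF a] by simp
  moreover have "l u \<le> p u" if "u \<in> V" for u
    using l(2)[OF that] r(2)[OF that] by simp
  ultimately show ?thesis
    using that[of l] add scale a by (simp add: order_antisym)
qed

section \<open>The compact-open topology\<close>

lemma topspace_Ck [simp]: "topspace (Ck X) = Ck_carrier X"
proof -
  have "Ck_carrier X \<in> {{f \<in> Ck_carrier X. f ` K \<subseteq> U} | K U. compactin X K \<and> open U}"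
    by (rule CollectI, rule exI[of _ "{}"], rule exI[of _ UNIV]) auto
  then show ?thesis
    unfolding Ck_def topology_generated_by_topspace by blast
qed

lemma Ck_carrier_zero [simp]: "(\<lambda>_. 0) \<in> Ck_carrier X"
  by (simp add: Ck_carrier_def)

lemma Ck_carrier_continuous: "f \<in> Ck_carrier X \<Longrightarrow> continuous_map X euclideanreal f"
  by (simp add: Ck_carrier_def)

lemma openin_Ck_subbasic:
  assumes "compactin X K" "open U"
  shows "openin (Ck X) {f \<in> Ck_carrier X. f ` K \<subseteq> U}"
  unfolding Ck_def by (rule topology_generated_by_Basis) (use assms in blast)

lemma compact_image_margin:
  fixes f :: "'a \<Rightarrow> real"
  assumes K: "compactin X K" and f: "continuous_map X euclideanreal f"
    and U: "open U" "f ` K \<subseteq> U"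
  obtains e where "e > 0" "\<And>x t. x \<in> K \<Longrightarrow> \<bar>t - f x\<bar> < e \<Longrightarrow> t \<in> U"
proof -
  have c: "compact (f ` K)"
    using image_compactin[OF K f] by simp
  obtain e where "e > 0" and e: "(\<Union>y\<in>f ` K. ball y e) \<subseteq> U"
    using compact_subset_open_imp_ball_epsilon_subset[OF c U] by metis
  show ?thesis
  proof
    show "e > 0" by fact
    show "t \<in> U" if "x \<in> K" "\<bar>t - f x\<bar> < e" for x t
      using that e by (force simp: dist_real_def abs_minus_commute)
  qed
qed

text \<open>Induction over the generation of the topology: an intersection takes the union of the
  compact sets and the smaller radius, and a subbasic set has a positive margin around the compact
  image.\<close>

lemma openin_Ck_ball_subset:
  assumes "openin (Ck X) U" "f \<in> U"
  shows "\<exists>K e. compactin X K \<and> e > 0 \<and> {g \<in> Ck_carrier X. \<forall>x\<in>K. \<bar>g x - f x\<bar> < e} \<subseteq> U"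
proof -
  have "generate_topology_on {{f \<in> Ck_carrier X. f ` K \<subseteq> U} | K U. compactin X K \<and> open U} U"
    using assms(1) by (simp add: Ck_def openin_topology_generated_by_iff)
  then show ?thesis using assms(2)
  proof (induction rule: generate_topology_on.induct)
    case Empty
    then show ?case by simp
  next
    case (Int a b)
    then obtain K1 e1 K2 e2 where
      1: "compactin X K1" "e1 > 0" "{g \<in> Ck_carrier X. \<forall>x\<in>K1. \<bar>g x - f x\<bar> < e1} \<subseteq> a" and
      2: "compactin X K2" "e2 > 0" "{g \<in> Ck_carrier X. \<forall>x\<in>K2. \<bar>g x - f x\<bar> < e2} \<subseteq> b"
      by blast
    show ?case
      using 1 2 by (intro exI[of _ "K1 \<union> K2"] exI[of _ "min e1 e2"]) (auto simp: compactin_Un)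
  next
    case (UN \<K>)
    then show ?case by (meson Union_iff Union_upper order_trans)
  next
    case (Basis s)
    then obtain K U where KU: "compactin X K" "open U" and s: "s = {f \<in> Ck_carrier X. f ` K \<subseteq> U}"
      by blast
    with Basis have f: "f ` K \<subseteq> U" "continuous_map X euclideanreal f"
      by (auto simp: Ck_carrier_def)
    obtain e where "e > 0" "\<And>x t. x \<in> K \<Longrightarrow> \<bar>t - f x\<bar> < e \<Longrightarrow> t \<in> U"
      using compact_image_margin[OF KU(1) f(2) KU(2) f(1)] by metis
    then show ?case
      using KU(1) unfolding s by (intro exI[of _ K] exI[of _ e]) auto
  qed
qed

text \<open>Sup-balls on a compact set are not subbasic; \<open>K\<close> is cut into finitely many compact pieces
  on which \<open>f\<close> oscillates little.\<close>

lemma Ck_ball_neighbourhood: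
  assumes f: "f \<in> Ck_carrier X" and K: "compactin X K" and e: "e > 0"
  shows "\<exists>V. openin (Ck X) V \<and> f \<in> V \<and> V \<subseteq> {g \<in> Ck_carrier X. \<forall>x\<in>K. \<bar>g x - f x\<bar> < e}"
proof -
  note cont = Ck_carrier_continuous[OF f]
  \<comment> \<open>On \<open>A c\<close> the function \<open>f\<close> stays within
    \<open>e/3\<close> of \<open>c\<close>, so it satisfies the weaker \<open>e/2\<close> condition
    defining \<open>V\<close>; any \<open>g\<close> in \<open>V\<close> then differs from
    \<open>f\<close> by less than \<open>e/2 + e/3 < e\<close>.\<close>
  define A where "A = (\<lambda>c. {y \<in> topspace X. f y \<in> cball c (e/3)} \<inter> K)"
  have A: "compactin X (A c)" for c
    unfolding A_def
    by (intro closed_Int_compactin K closedin_continuous_map_preimage[OF cont]) auto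
  have "compact (f ` K)" using image_compactin[OF K cont] by simp
  moreover have "f ` K \<subseteq> (\<Union>c\<in>f ` K. ball c (e/3))" using e by auto
  ultimately obtain C where C: "C \<subseteq> f ` K" "finite C" "f ` K \<subseteq> (\<Union>c\<in>C. ball c (e/3))"
    using compactE_image[of "f ` K" "f ` K" "\<lambda>c. ball c (e/3)"] by (metis open_ball)
  \<comment> \<open>For empty \<open>K\<close> the intersection over \<open>C\<close> is the whole
    type; the last factor cuts it back to the carrier.\<close>
  define V where "V = (\<Inter>c\<in>C. {g \<in> Ck_carrier X. g ` A c \<subseteq> ball c (e/2)}) \<inter> Ck_carrier X"
  have "openin (Ck X) V"
  proof (cases "C = {}")
    case True
    then show ?thesis using openin_topspace[of "Ck X"] by (simp add: V_def)
  next
    case False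
    then show ?thesis unfolding V_def
      by (intro openin_Int openin_INT2 C openin_Ck_subbasic A) (use openin_topspace[of "Ck X"] in auto)
  qed
  moreover have "f \<in> V" using f e by (auto simp: V_def A_def)
  moreover have "\<bar>g x - f x\<bar> < e" if g: "g \<in> V" and x: "x \<in> K" for g x
  proof -
    obtain c where c: "c \<in> C" "f x \<in> ball c (e/3)" using C(3) x by blast
    then have "x \<in> A c" using x K by (auto simp: A_def compactin_def)
    then have "g x \<in> ball c (e/2)" using g c(1) unfolding V_def by blast
    then show ?thesis using c(2) e unfolding mem_ball dist_real_def by linarith
  qed
  ultimately show ?thesis by (intro exI[of _ V]) (auto simp: V_def)
qed

lemma nhd_in_Ck_zero_iff:
  "nhd_in (Ck X) (\<lambda>_. 0) N \<longleftrightarrow> N \<subseteq> Ck_carrier X \<and>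
     (\<exists>K e. compactin X K \<and> e > 0 \<and> {g \<in> Ck_carrier X. \<forall>x\<in>K. \<bar>g x\<bar> < e} \<subseteq> N)"
    (is "?L \<longleftrightarrow> ?R")
proof
  assume ?L
  then show ?R
    using openin_Ck_ball_subset[of X _ "\<lambda>_. 0"] by (fastforce simp: nhd_in_def)
next
  assume ?R
  then obtain K e where "N \<subseteq> Ck_carrier X" "compactin X K" "e > 0"
    "{g \<in> Ck_carrier X. \<forall>x\<in>K. \<bar>g x\<bar> < e} \<subseteq> N" by blast
  then show ?L
    using Ck_ball_neighbourhood[OF Ck_carrier_zero, of X K e]
    unfolding nhd_in_def topspace_Ck diff_0_right by (meson order_trans)
qed

lemma continuous_map_Ck_eval:
  assumes "x \<in> topspace X"
  shows "continuous_map (Ck X) euclideanreal (\<lambda>f. f x)"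
proof -
  have "openin (Ck X) {f \<in> Ck_carrier X. f x \<in> U}" if "open U" for U
    using openin_Ck_subbasic[of X "{x}" U] that assms by simp
  then show ?thesis by (simp add: continuous_map_def)
qed

lemma compactin_Ck_pointwise_bounded:
  assumes "compactin (Ck X) C" "x \<in> topspace X"
  shows "\<exists>M. \<forall>f\<in>C. \<bar>f x\<bar> \<le> M"
proof -
  have "compact ((\<lambda>f. f x) ` C)"
    using image_compactin[OF assms(1) continuous_map_Ck_eval[OF assms(2)]] by simp
  then show ?thesis
    using compact_imp_bounded bounded_iff by (metis image_eqI real_norm_def)
qed

lemma equicontinuous_on_imp_continuous_map:
  assumes eq: "equicontinuous_on X H" and f: "f \<in> H"
  shows "continuous_map X euclideanreal f"
  unfolding Met_TC.continuous_map_to_metric[unfolded mtopology_is_euclidean]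
proof (intro ballI allI impI)
  fix x and e :: real assume "x \<in> topspace X" "e > 0"
  then obtain W where W: "openin X W" "x \<in> W" and "\<forall>f\<in>H. \<forall>y\<in>W. \<bar>f y - f x\<bar> < e"
    using eq unfolding equicontinuous_on_def by meson
  with f have "\<bar>f y - f x\<bar> < e" if "y \<in> W" for y using that by simp
  then have "\<forall>y\<in>W. f y \<in> Met_TC.mball (f x) e" by (simp add: dist_real_def abs_minus_commute)
  with W show "\<exists>U. openin X U \<and> x \<in> U \<and> (\<forall>y\<in>U. f y \<in> Met_TC.mball (f x) e)" by (intro exI conjI)
qed

text \<open>The bounds and oscillation estimates of \<open>H\<close> define a set \<open>E\<close>
  that is closed in a product of compact intervals, hence compact for pointwise convergence by
  Tychonoff. On an equicontinuous set, closeness at finitely many points gives closeness on a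
  compact set, so the identity from \<open>E\<close> into \<open>Ck X\<close> is continuous and
  transports compactness.\<close>

theorem arzela_ascoli_Ck:
  assumes H: "H \<subseteq> Ck_carrier X" and eq: "equicontinuous_on X H"
    and bdd: "\<And>x. x \<in> topspace X \<Longrightarrow> \<exists>M. \<forall>f\<in>H. \<bar>f x\<bar> \<le> M"
  obtains E where "compactin (Ck X) E" "H \<subseteq> E"
proof -
  obtain M where M: "\<And>x f. x \<in> topspace X \<Longrightarrow> f \<in> H \<Longrightarrow> \<bar>f x\<bar> \<le> M x"
    using bdd by metis
  \<comment> \<open>Strict inequalities are weakened so that the conditions imposed on
    \<open>E\<close> are closed.\<close>
  have "\<exists>W. openin X W \<and> x \<in> W \<and> (\<forall>f\<in>H. \<forall>y\<in>W. \<bar>f y - f x\<bar> \<le> e)"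
    if "x \<in> topspace X" "e > 0" for x e
    using eq that unfolding equicontinuous_on_def by (meson less_imp_le)
  then obtain W where W: "\<And>x e. x \<in> topspace X \<Longrightarrow> e > 0 \<Longrightarrow> openin X (W x e) \<and> x \<in> W x e"
    and HW: "\<And>x e f y. x \<in> topspace X \<Longrightarrow> e > 0 \<Longrightarrow> f \<in> H \<Longrightarrow> y \<in> W x e \<Longrightarrow> \<bar>f y - f x\<bar> \<le> e"
    by metis
  \<comment> \<open>The factor \<open>{0}\<close> off the space keeps the normalisation required by
    \<open>Ck_carrier\<close>.\<close>
  define B where "B = (\<lambda>x. if x \<in> topspace X then {- M x..M x} else {0})"
  define E where "E = Pi UNIV B \<inter> (\<Inter>x\<in>topspace X. \<Inter>e\<in>{0<..}. \<Inter>y\<in>W x e. {f. \<bar>f y - f x\<bar> \<le> e})"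
  have "compact (Pi UNIV B)"
    using compactin_PiE[of "\<lambda>_. euclideanreal" UNIV B]
    by (simp add: euclidean_product_topology PiE_UNIV_domain B_def)
  moreover have "closed {f :: 'a \<Rightarrow> real. \<bar>f y - f x\<bar> \<le> e}" for x y e
    by (intro closed_Collect_le continuous_intros continuous_on_product_coordinates)
  ultimately have cE: "compact E"
    unfolding E_def by (intro compact_Int_closed closed_INT ballI)
  have EW: "\<bar>f y - f x\<bar> \<le> e" if "f \<in> E" "x \<in> topspace X" "e > 0" "y \<in> W x e" for f x y e
    using that by (auto simp: E_def)
  have eqE: "equicontinuous_on X E"
    unfolding equicontinuous_on_def
  proof (intro ballI allI impI)
    fix x and e :: real assume x: "x \<in> topspace X" and "e > 0"
    then have e: "e/2 > 0" by simp
    have "\<bar>f y - f x\<bar> < e" if "f \<in> E" "y \<in> W x (e/2)" for f y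
      using EW[OF that(1) x e that(2)] e by linarith
    then show "\<exists>V. openin X V \<and> x \<in> V \<and> (\<forall>f\<in>E. \<forall>y\<in>V. \<bar>f y - f x\<bar> < e)"
      using W[OF x e] by (intro exI[of _ "W x (e/2)"]) auto
  qed
  have EC: "E \<subseteq> Ck_carrier X"
  proof
    fix f assume f: "f \<in> E"
    have "continuous_map X euclideanreal f"
      by (rule equicontinuous_on_imp_continuous_map[OF eqE f])
    moreover have "f x = 0" if "x \<notin> topspace X" for x
    proof -
      have "f x \<in> B x" using f by (auto simp: E_def)
      then show ?thesis using that by (simp add: B_def)
    qed
    ultimately show "f \<in> Ck_carrier X" by (simp add: Ck_carrier_def)
  qed
  have "continuous_map (top_of_set E) (Ck X) (\<lambda>f. f)"
    unfolding continuous_map_def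
  proof (intro conjI allI impI)
    show "(\<lambda>f. f) \<in> topspace (top_of_set E) \<rightarrow> topspace (Ck X)" using EC by auto
    fix U assume U: "openin (Ck X) U"
    have "\<exists>T. openin (top_of_set E) T \<and> f \<in> T \<and> T \<subseteq> E \<inter> U" if f: "f \<in> E \<inter> U" for f
    proof -
      obtain K e where K: "compactin X K" and e: "e > 0"
        and KU: "{g \<in> Ck_carrier X. \<forall>x\<in>K. \<bar>g x - f x\<bar> < e} \<subseteq> U"
        using openin_Ck_ball_subset[OF U, of f] f by blast
      have KX: "K \<subseteq> topspace X" using K by (simp add: compactin_def)
      have "\<exists>\<F>. finite \<F> \<and> \<F> \<subseteq> (\<lambda>x. W x (e/4)) ` K \<and> K \<subseteq> \<Union>\<F>"
      proof (rule compactinD[OF K])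
        show "openin X S" if "S \<in> (\<lambda>x. W x (e/4)) ` K" for S
          using that W[of _ "e/4"] e KX by auto
        show "K \<subseteq> \<Union>((\<lambda>x. W x (e/4)) ` K)"
          using W[of _ "e/4"] e KX by auto
      qed
      then obtain A where A: "finite A" "A \<subseteq> K" "K \<subseteq> (\<Union>x\<in>A. W x (e/4))"
        by (metis finite_subset_image)
      \<comment> \<open>Passing from \<open>g y\<close> to \<open>g x\<close> to \<open>f x\<close>
        to \<open>f y\<close> costs at most \<open>e/4\<close> each time, which stays below
        \<open>e\<close>.\<close>
      define T where "T = (\<Inter>x\<in>A. {g :: 'a \<Rightarrow> real. \<bar>g x - f x\<bar> < e/4})"
      have "open T"
        unfolding T_def
        by (intro open_INT A ballI open_Collect_less continuous_intros
            continuous_on_product_coordinates)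
      have "g \<in> U" if g: "g \<in> E \<inter> T" for g
      proof -
        have "\<bar>g y - f y\<bar> < e" if y: "y \<in> K" for y
        proof -
          obtain x where x: "x \<in> A" "y \<in> W x (e/4)" using A y by blast
          have xX: "x \<in> topspace X" using x A KX by blast
          have "\<bar>g x - f x\<bar> < e/4" using g x(1) by (auto simp: T_def)
          moreover have "\<bar>g y - g x\<bar> \<le> e/4" "\<bar>f y - f x\<bar> \<le> e/4"
            using EW[OF _ xX _ x(2)] f g e by auto
          ultimately show ?thesis using e by linarith
        qed
        then show ?thesis using KU g EC by blast
      qed
      moreover have "f \<in> T" using e by (simp add: T_def)
      ultimately show ?thesis
        using f \<open>open T\<close> by (intro exI[of _ "E \<inter> T"]) (auto simp: openin_open)
    qed
    then have "openin (top_of_set E) (E \<inter> U)"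
      by (subst openin_subopen) blast
    moreover have "{f \<in> topspace (top_of_set E). f \<in> U} = E \<inter> U" by auto
    ultimately show "openin (top_of_set E) {f \<in> topspace (top_of_set E). f \<in> U}" by simp
  qed
  from image_compactin[OF _ this, of E] cE have "compactin (Ck X) E"
    by (simp add: compactin_subtopology)
  moreover have "H \<subseteq> E"
  proof
    fix f assume f: "f \<in> H"
    have "f x \<in> B x" for x
      using M[OF _ f, of x] H f by (auto simp: B_def Ck_carrier_def)
    then show "f \<in> E" using HW[OF _ _ f] by (auto simp: E_def)
  qed
  ultimately show ?thesis using that by blast
qed

section \<open>Seminorms on the free vector space\<close>

text \<open>The linear extension of \<open>f\<close> to L(X), evaluated at \<mu>.\<close>

definition pairing :: "('a \<Rightarrow> real) \<Rightarrow> ('a \<Rightarrow> real) \<Rightarrow> real" where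
  "pairing \<mu> f = (\<Sum>y | \<mu> y \<noteq> 0. \<mu> y * f y)"

definition polar :: "'a topology \<Rightarrow> ('a \<Rightarrow> real) set \<Rightarrow> ('a \<Rightarrow> real) set" where
  "polar X H = {\<mu> \<in> L_carrier X. \<forall>f\<in>H. \<bar>pairing \<mu> f\<bar> \<le> 1}"

lemma polar_antimono: "H \<subseteq> H' \<Longrightarrow> polar X H' \<subseteq> polar X H"
  by (auto simp: polar_def)

lemma L_carrier_subspace: "function_subspace (L_carrier X)"
  unfolding function_subspace_def L_carrier_def
proof (intro conjI ballI allI)
  fix u v :: "'a \<Rightarrow> real"
  assume uv: "u \<in> {f. finite {y. f y \<noteq> 0} \<and> {y. f y \<noteq> 0} \<subseteq> topspace X}"
    "v \<in> {f. finite {y. f y \<noteq> 0} \<and> {y. f y \<noteq> 0} \<subseteq> topspace X}"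
  have "{y. u y + v y \<noteq> 0} \<subseteq> {y. u y \<noteq> 0} \<union> {y. v y \<noteq> 0}" by auto
  with uv show "(\<lambda>y. u y + v y) \<in> {f. finite {y. f y \<noteq> 0} \<and> {y. f y \<noteq> 0} \<subseteq> topspace X}"
    by (auto intro: finite_subset)
next
  fix c :: real and u :: "'a \<Rightarrow> real"
  assume u: "u \<in> {f. finite {y. f y \<noteq> 0} \<and> {y. f y \<noteq> 0} \<subseteq> topspace X}"
  have "{y. c * u y \<noteq> 0} \<subseteq> {y. u y \<noteq> 0}" by auto
  with u show "(\<lambda>y. c * u y) \<in> {f. finite {y. f y \<noteq> 0} \<and> {y. f y \<noteq> 0} \<subseteq> topspace X}"
    by (auto intro: finite_subset)
qed simp

lemmas L_carrier_closed = function_subspaceD[OF L_carrier_subspace]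

lemma L_delta_in_L_carrier [simp]: "L_delta x \<in> L_carrier X \<longleftrightarrow> x \<in> topspace X"
  by (auto simp: L_carrier_def L_delta_def)

lemma pairing_superset:
  assumes "finite A" "{y. \<mu> y \<noteq> 0} \<subseteq> A"
  shows "pairing \<mu> f = (\<Sum>y\<in>A. \<mu> y * f y)"
  unfolding pairing_def by (rule sum.mono_neutral_left) (use assms in auto)

lemma pairing_add:
  assumes "u \<in> L_carrier X" "v \<in> L_carrier X"
  shows "pairing (\<lambda>y. u y + v y) f = pairing u f + pairing v f"
proof -
  let ?A = "{y. u y \<noteq> 0} \<union> {y. v y \<noteq> 0}"
  have A: "finite ?A" using assms by (simp add: L_carrier_def)
  show ?thesis
    using pairing_superset[OF A, of u] pairing_superset[OF A, of v]
      pairing_superset[OF A, of "\<lambda>y. u y + v y"]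
    by (simp add: sum.distrib distrib_right subset_iff)
qed

lemma pairing_scale: "pairing (\<lambda>y. c * u y) f = c * pairing u f"
  by (cases "c = 0") (simp_all add: pairing_def sum_distrib_left mult.assoc)

lemma pairing_scale_right: "pairing u (\<lambda>y. c * f y) = c * pairing u f"
  by (simp add: pairing_def sum_distrib_left mult.left_commute)

lemma pairing_diff:
  assumes "u \<in> L_carrier X" "v \<in> L_carrier X"
  shows "pairing (\<lambda>y. u y - v y) f = pairing u f - pairing v f"
  using pairing_add[OF assms(1) L_carrier_closed(4)[OF assms(2)]] pairing_scale[of "-1" v f]
  by simp

lemma pairing_L_delta [simp]: "pairing (L_delta x) f = f x"
proof -
  have "{y. L_delta x y \<noteq> 0} = {x}" by (auto simp: L_delta_def)
  then show ?thesis by (simp add: pairing_def) (simp add: L_delta_def)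
qed

lemma L_carrier_eq_sum_L_delta:
  assumes "u \<in> L_carrier X"
  shows "u = (\<lambda>z. \<Sum>y | u y \<noteq> 0. u y * L_delta y z)"
proof
  fix z
  have "(\<Sum>y | u y \<noteq> 0. u y * L_delta y z) = (\<Sum>y | u y \<noteq> 0. if y = z then u y else 0)"
    by (rule sum.cong) (auto simp: L_delta_def)
  also have "\<dots> = u z"
    using assms by (simp add: L_carrier_def)
  finally show "u z = (\<Sum>y | u y \<noteq> 0. u y * L_delta y z)" by simp
qed

text \<open>Point masses span, so induction over the finite support suffices. Membership in the
  carrier is carried through the induction because linearity of \<open>l\<close> is available only
  there.\<close>

lemma linear_functional_eq_pairing:
  assumes add: "\<And>u v. u \<in> L_carrier X \<Longrightarrow> v \<in> L_carrier X \<Longrightarrow> l (\<lambda>y. u y + v y) = l u + l v"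
    and scale: "\<And>c u. u \<in> L_carrier X \<Longrightarrow> l (\<lambda>y. c * u y) = c * l u"
    and f: "\<And>x. x \<in> topspace X \<Longrightarrow> f x = l (L_delta x)"
    and u: "u \<in> L_carrier X"
  shows "l u = pairing u f"
proof -
  have "(\<lambda>z. \<Sum>y\<in>A. u y * L_delta y z) \<in> L_carrier X \<and>
      l (\<lambda>z. \<Sum>y\<in>A. u y * L_delta y z) = (\<Sum>y\<in>A. u y * f y)"
    if "finite A" "A \<subseteq> topspace X" for A
    using that
  proof (induction A rule: finite_induct)
    case empty
    have "l (\<lambda>_. 0) = 0" using scale[OF L_carrier_closed(1), of 0] by simp
    then show ?case by (simp add: L_carrier_closed)
  next
    case (insert x A)
    then show ?case
      using add[of "\<lambda>z. u x * L_delta x z" "\<lambda>z. \<Sum>y\<in>A. u y * L_delta y z"]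
        scale[of "L_delta x" "u x"] f[of x]
      by (simp add: L_carrier_closed)
  qed
  from this[of "{y. u y \<noteq> 0}"] u L_carrier_eq_sum_L_delta[OF u] show ?thesis
    by (simp add: L_carrier_def pairing_def)
qed

section \<open>Seminorms, their extension theorem and the locally convex topologies they
  define\<close>

definition seminorm_on :: "('a \<Rightarrow> real) set \<Rightarrow> (('a \<Rightarrow> real) \<Rightarrow> real) \<Rightarrow> bool" where
  "seminorm_on V p \<longleftrightarrow> (\<forall>u\<in>V. \<forall>v\<in>V. p (\<lambda>y. u y + v y) \<le> p u + p v) \<and>
     (\<forall>c. \<forall>u\<in>V. p (\<lambda>y. c * u y) = \<bar>c\<bar> * p u)"

lemma seminorm_onD:
  assumes "seminorm_on V p"
  shows "\<And>u v. u \<in> V \<Longrightarrow> v \<in> V \<Longrightarrow> p (\<lambda>y. u y + v y) \<le> p u + p v"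
    "\<And>c u. u \<in> V \<Longrightarrow> p (\<lambda>y. c * u y) = \<bar>c\<bar> * p u"
    "\<And>u. u \<in> V \<Longrightarrow> p (\<lambda>y. - u y) = p u"
proof -
  show "\<And>u v. u \<in> V \<Longrightarrow> v \<in> V \<Longrightarrow> p (\<lambda>y. u y + v y) \<le> p u + p v"
    and s: "\<And>c u. u \<in> V \<Longrightarrow> p (\<lambda>y. c * u y) = \<bar>c\<bar> * p u"
    using assms by (auto simp: seminorm_on_def)
  show "p (\<lambda>y. - u y) = p u" if "u \<in> V" for u
    using s[OF that, of "-1"] by simp
qed

lemma seminorm_onI:
  assumes V: "function_subspace V"
    and add: "\<And>u v. u \<in> V \<Longrightarrow> v \<in> V \<Longrightarrow> p (\<lambda>y. u y + v y) \<le> p u + p v"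
    and scale: "\<And>c u. u \<in> V \<Longrightarrow> p (\<lambda>y. c * u y) \<le> \<bar>c\<bar> * p u"
  shows "seminorm_on V p"
  unfolding seminorm_on_def
proof (intro conjI ballI allI)
  fix c :: real and u assume u: "u \<in> V"
  show "p (\<lambda>y. c * u y) = \<bar>c\<bar> * p u"
  proof (cases "c = 0")
    case True
    note z = function_subspaceD(1)[OF V]
    have "p (\<lambda>_. 0) = 0" using add[OF z z] scale[OF z, of 0] by simp
    with True show ?thesis by simp
  next
    case False
    have "p u = p (\<lambda>y. inverse c * (c * u y))" using False by (simp add: field_simps)
    also have "\<dots> \<le> \<bar>inverse c\<bar> * p (\<lambda>y. c * u y)"
      by (rule scale) (rule function_subspaceD(3)[OF V u])
    finally have "\<bar>c\<bar> * p u \<le> p (\<lambda>y. c * u y)"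
      using False by (simp add: field_simps)
    with scale[OF u, of c] show ?thesis by simp
  qed
qed (use add in auto)

text \<open>A seminorm is sublinear and takes equal values at \<open>u\<close> and
  \<open>- u\<close>, so a functional below it is also bounded in absolute value. The function is
  read off at the point masses and set to 0 elsewhere to match \<open>Ck_carrier\<close>.\<close>

lemma L_carrier_hahn_banach:
  assumes p: "seminorm_on (L_carrier X) p" and a: "a \<in> L_carrier X"
  obtains f where "\<And>x. x \<notin> topspace X \<Longrightarrow> f x = 0"
    "\<And>u. u \<in> L_carrier X \<Longrightarrow> \<bar>pairing u f\<bar> \<le> p u" "pairing a f = p a"
proof -
  have "sublinear_on (L_carrier X) p"
    using p by (simp add: seminorm_on_def sublinear_on_def)
  from hahn_banach_sublinear[OF L_carrier_subspace this a]
  obtain l where add: "\<And>u v. u \<in> L_carrier X \<Longrightarrow> v \<in> L_carrier X \<Longrightarrow> l (\<lambda>y. u y + v y) = l u + l v"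
    and scale: "\<And>c u. u \<in> L_carrier X \<Longrightarrow> l (\<lambda>y. c * u y) = c * l u"
    and le: "\<And>u. u \<in> L_carrier X \<Longrightarrow> l u \<le> p u" and la: "l a = p a"
    by blast
  define f where "f = (\<lambda>x. if x \<in> topspace X then l (L_delta x) else 0)"
  have l: "l u = pairing u f" if "u \<in> L_carrier X" for u
    by (rule linear_functional_eq_pairing[OF add scale _ that]) (auto simp: f_def)
  have "\<bar>pairing u f\<bar> \<le> p u" if u: "u \<in> L_carrier X" for u
    using le[OF u] le[OF L_carrier_closed(4)[OF u]] l[OF u] scale[OF u, of "-1"]
      seminorm_onD(3)[OF p u] by simp
  then show ?thesis
    using that[of f] l[OF a] la by (simp add: f_def)
qed

definition seminorm_topology :: "('a \<Rightarrow> real) set \<Rightarrow> (('a \<Rightarrow> real) \<Rightarrow> real) \<Rightarrow> ('a \<Rightarrow> real) topology" where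
  "seminorm_topology V p = topology (\<lambda>U. U \<subseteq> V \<and>
     (\<forall>u\<in>U. \<exists>e>0. \<forall>v\<in>V. p (\<lambda>y. v y - u y) < e \<longrightarrow> v \<in> U))"

lemma openin_seminorm_topology:
  "openin (seminorm_topology V p) U \<longleftrightarrow> U \<subseteq> V \<and>
     (\<forall>u\<in>U. \<exists>e>0. \<forall>v\<in>V. p (\<lambda>y. v y - u y) < e \<longrightarrow> v \<in> U)"
proof -
  have "istopology (\<lambda>U. U \<subseteq> V \<and> (\<forall>u\<in>U. \<exists>e>0. \<forall>v\<in>V. p (\<lambda>y. v y - u y) < e \<longrightarrow> v \<in> U))"
    unfolding istopology_def
  proof (intro conjI allI impI)
    fix S T
    assume S: "S \<subseteq> V \<and> (\<forall>u\<in>S. \<exists>e>0. \<forall>v\<in>V. p (\<lambda>y. v y - u y) < e \<longrightarrow> v \<in> S)"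
      and T: "T \<subseteq> V \<and> (\<forall>u\<in>T. \<exists>e>0. \<forall>v\<in>V. p (\<lambda>y. v y - u y) < e \<longrightarrow> v \<in> T)"
    show "S \<inter> T \<subseteq> V" using S by blast
    show "\<forall>u\<in>S \<inter> T. \<exists>e>0. \<forall>v\<in>V. p (\<lambda>y. v y - u y) < e \<longrightarrow> v \<in> S \<inter> T"
    proof
      fix u assume "u \<in> S \<inter> T"
      then obtain d e where "d > 0" "\<forall>v\<in>V. p (\<lambda>y. v y - u y) < d \<longrightarrow> v \<in> S"
        "e > 0" "\<forall>v\<in>V. p (\<lambda>y. v y - u y) < e \<longrightarrow> v \<in> T" using S T by blast
      then show "\<exists>e>0. \<forall>v\<in>V. p (\<lambda>y. v y - u y) < e \<longrightarrow> v \<in> S \<inter> T"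
        by (intro exI[of _ "min d e"]) auto
    qed
  next
    fix \<K> assume K: "\<forall>U\<in>\<K>. U \<subseteq> V \<and> (\<forall>u\<in>U. \<exists>e>0. \<forall>v\<in>V. p (\<lambda>y. v y - u y) < e \<longrightarrow> v \<in> U)"
    then show "\<Union>\<K> \<subseteq> V" by blast
    show "\<forall>u\<in>\<Union>\<K>. \<exists>e>0. \<forall>v\<in>V. p (\<lambda>y. v y - u y) < e \<longrightarrow> v \<in> \<Union>\<K>"
      using K by (meson Union_iff)
  qed
  then show ?thesis unfolding seminorm_topology_def by simp
qed

lemma openin_seminorm_topologyE:
  assumes "openin (seminorm_topology V p) U" "u \<in> U"
  obtains e where "e > 0" "\<And>v. v \<in> V \<Longrightarrow> p (\<lambda>y. v y - u y) < e \<Longrightarrow> v \<in> U"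
proof -
  have "\<forall>u\<in>U. \<exists>e>0. \<forall>v\<in>V. p (\<lambda>y. v y - u y) < e \<longrightarrow> v \<in> U"
    using assms(1) by (simp add: openin_seminorm_topology)
  from bspec[OF this assms(2)] show ?thesis using that by auto
qed

lemma topspace_seminorm_topology [simp]: "topspace (seminorm_topology V p) = V"
proof
  show "topspace (seminorm_topology V p) \<subseteq> V"
    using openin_topspace[of "seminorm_topology V p"] unfolding openin_seminorm_topology by blast
  have "openin (seminorm_topology V p) V"
    unfolding openin_seminorm_topology by (auto intro: exI[of _ 1])
  then show "V \<subseteq> topspace (seminorm_topology V p)" by (rule openin_subset)
qed

lemma seminorm_triangle:
  assumes V: "function_subspace V" and p: "seminorm_on V p"
    and "u \<in> V" "v \<in> V" "w \<in> V"
  shows "p (\<lambda>y. u y - w y) \<le> p (\<lambda>y. u y - v y) + p (\<lambda>y. v y - w y)"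
  using seminorm_onD(1)[OF p, of "\<lambda>y. u y - v y" "\<lambda>y. v y - w y"] assms(3-)
    function_subspaceD[OF V] by simp

lemma openin_seminorm_ball:
  assumes V: "function_subspace V" and p: "seminorm_on V p" and u: "u \<in> V"
  shows "openin (seminorm_topology V p) {v \<in> V. p (\<lambda>y. v y - u y) < e}"
  unfolding openin_seminorm_topology
proof (intro conjI ballI)
  fix v assume v: "v \<in> {v \<in> V. p (\<lambda>y. v y - u y) < e}"
  then show "\<exists>d>0. \<forall>w\<in>V. p (\<lambda>y. w y - v y) < d \<longrightarrow> w \<in> {v \<in> V. p (\<lambda>y. v y - u y) < e}"
    using seminorm_triangle[OF V p _ _ u]
    by (intro exI[of _ "e - p (\<lambda>y. v y - u y)"]) force
qed auto

lemma seminorm_zero: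
  assumes V: "function_subspace V" and p: "seminorm_on V p"
  shows "p (\<lambda>_. 0) = 0"
  using seminorm_onD(2)[OF p function_subspaceD(1)[OF V], of 0] by simp

lemma seminorm_nonneg:
  assumes V: "function_subspace V" and p: "seminorm_on V p" and u: "u \<in> V"
  shows "0 \<le> p u"
  using seminorm_onD(1)[OF p u function_subspaceD(4)[OF V u]] seminorm_onD(3)[OF p u]
    seminorm_zero[OF V p] by simp

text \<open>This is the source of admissible topologies in the union that generates
  \<open>Lfree\<close>: a single seminorm is enough for each polar.\<close>

lemma lc_vector_topology_seminorm:
  assumes V: "function_subspace V" and p: "seminorm_on V p"
  shows "lc_vector_topology V (seminorm_topology V p)"
proof -
  let ?T = "seminorm_topology V p"
  note D = function_subspaceD[OF V]
  have self: "p (\<lambda>y. u y - u y) = 0" for u :: "'a \<Rightarrow> real" using seminorm_zero[OF V p] by simp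
  have "continuous_map (prod_topology ?T ?T) ?T (\<lambda>(u, v). \<lambda>y. u y + v y)"
    unfolding continuous_map_def
  proof (intro conjI allI impI)
    show "(\<lambda>(u, v). \<lambda>y. u y + v y) \<in> topspace (prod_topology ?T ?T) \<rightarrow> topspace ?T"
      using D(2) by auto
    fix U assume U: "openin ?T U"
    show "openin (prod_topology ?T ?T)
        {z \<in> topspace (prod_topology ?T ?T). (case z of (u, v) \<Rightarrow> \<lambda>y. u y + v y) \<in> U}"
      unfolding openin_prod_topology_alt
    proof (intro allI impI)
      fix u v
      assume "(u, v) \<in> {z \<in> topspace (prod_topology ?T ?T). (case z of (u, v) \<Rightarrow> \<lambda>y. u y + v y) \<in> U}"
      then have uv: "u \<in> V" "v \<in> V" "(\<lambda>y. u y + v y) \<in> U" by auto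
      obtain e where e: "e > 0" "\<And>w. w \<in> V \<Longrightarrow> p (\<lambda>y. w y - (u y + v y)) < e \<Longrightarrow> w \<in> U"
        by (rule openin_seminorm_topologyE[OF U uv(3)]) (rule that)
      have "(\<lambda>y. u' y + v' y) \<in> U"
        if "u' \<in> V" "v' \<in> V" "p (\<lambda>y. u' y - u y) < e/2" "p (\<lambda>y. v' y - v y) < e/2" for u' v'
      proof (rule e(2))
        have "p (\<lambda>y. u' y + v' y - (u y + v y)) = p (\<lambda>y. (u' y - u y) + (v' y - v y))"
          by (simp add: algebra_simps)
        also have "\<dots> \<le> p (\<lambda>y. u' y - u y) + p (\<lambda>y. v' y - v y)"
          using that uv by (intro seminorm_onD(1)[OF p] D)
        finally show "p (\<lambda>y. u' y + v' y - (u y + v y)) < e" using that by simp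
      qed (use that D in auto)
      then show "\<exists>A B. openin ?T A \<and> openin ?T B \<and> u \<in> A \<and> v \<in> B \<and> A \<times> B \<subseteq>
          {z \<in> topspace (prod_topology ?T ?T). (case z of (u, v) \<Rightarrow> \<lambda>y. u y + v y) \<in> U}"
        using uv e(1) self
        by (intro exI[of _ "{w \<in> V. p (\<lambda>y. w y - u y) < e/2}"]
            exI[of _ "{w \<in> V. p (\<lambda>y. w y - v y) < e/2}"] conjI openin_seminorm_ball[OF V p]) auto
    qed
  qed
  moreover have "continuous_map (prod_topology euclideanreal ?T) ?T (\<lambda>(c, v). \<lambda>y. c * v y)"
    unfolding continuous_map_def
  proof (intro conjI allI impI)
    show "(\<lambda>(c, v). \<lambda>y. c * v y) \<in> topspace (prod_topology euclideanreal ?T) \<rightarrow> topspace ?T"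
      using D(3) by auto
    fix U assume U: "openin ?T U"
    show "openin (prod_topology euclideanreal ?T)
        {z \<in> topspace (prod_topology euclideanreal ?T). (case z of (c, v) \<Rightarrow> \<lambda>y. c * v y) \<in> U}"
      unfolding openin_prod_topology_alt
    proof (intro allI impI)
      fix c v
      assume "(c, v) \<in> {z \<in> topspace (prod_topology euclideanreal ?T).
        (case z of (c, v) \<Rightarrow> \<lambda>y. c * v y) \<in> U}"
      then have v: "v \<in> V" "(\<lambda>y. c * v y) \<in> U" by auto
      obtain e where e: "e > 0" "\<And>w. w \<in> V \<Longrightarrow> p (\<lambda>y. w y - c * v y) < e \<Longrightarrow> w \<in> U"
        by (rule openin_seminorm_topologyE[OF U v(2)]) (rule that)
      have pv: "p v \<ge> 0" by (rule seminorm_nonneg[OF V p v(1)])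
      \<comment> \<open>The error splits as \<open>c' (v' - v) + (c' - c) v\<close>. Here
        \<open>d\<close> makes the second term less than \<open>e/2\<close>, where the added 1
        covers \<open>p v = 0\<close>; since \<open>\<bar>c'\<bar>\<close> is below
        \<open>\<bar>c\<bar> + d\<close>, the radius \<open>r\<close> makes the first term at most
        \<open>e/2\<close>.\<close>
      define d where "d = e / (2 * (p v + 1))"
      define r where "r = e / (2 * (\<bar>c\<bar> + d))"
      have d: "d > 0" using e pv by (simp add: d_def)
      then have r: "r > 0" using e by (simp add: r_def)
      have "(\<lambda>y. c' * v' y) \<in> U"
        if c': "\<bar>c' - c\<bar> < d" and v': "v' \<in> V" "p (\<lambda>y. v' y - v y) < r" for c' v'
      proof (rule e(2))
        have "p (\<lambda>y. c' * v' y - c * v y) = p (\<lambda>y. c' * (v' y - v y) + (c' - c) * v y)"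
          by (simp add: algebra_simps)
        also have "\<dots> \<le> p (\<lambda>y. c' * (v' y - v y)) + p (\<lambda>y. (c' - c) * v y)"
          using v' v by (intro seminorm_onD(1)[OF p] D)
        also have "\<dots> = \<bar>c'\<bar> * p (\<lambda>y. v' y - v y) + \<bar>c' - c\<bar> * p v"
          using seminorm_onD(2)[OF p D(5)[OF v'(1) v(1)]] seminorm_onD(2)[OF p v(1)] by simp
        also have "\<dots> < e/2 + e/2"
        proof (rule add_le_less_mono)
          have "\<bar>c'\<bar> * p (\<lambda>y. v' y - v y) \<le> (\<bar>c\<bar> + d) * r"
            using c' v' seminorm_nonneg[OF V p D(5)[OF v'(1) v(1)]] d by (intro mult_mono) auto
          also have "\<dots> = e/2" using d by (simp add: r_def field_simps)
          finally show "\<bar>c'\<bar> * p (\<lambda>y. v' y - v y) \<le> e/2" .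
          have "\<bar>c' - c\<bar> * p v \<le> d * p v" using c' pv by (intro mult_right_mono) auto
          also have "\<dots> < d * (p v + 1)" using d by simp
          also have "\<dots> = e/2" using pv by (simp add: d_def field_simps)
          finally show "\<bar>c' - c\<bar> * p v < e/2" .
        qed
        finally show "p (\<lambda>y. c' * v' y - c * v y) < e" by simp
      qed (use v' D in auto)
      then show "\<exists>A B. openin euclideanreal A \<and> openin ?T B \<and> c \<in> A \<and> v \<in> B \<and> A \<times> B \<subseteq>
          {z \<in> topspace (prod_topology euclideanreal ?T). (case z of (c, v) \<Rightarrow> \<lambda>y. c * v y) \<in> U}"
        using v r d self
        by (intro exI[of _ "ball c d"] exI[of _ "{w \<in> V. p (\<lambda>y. w y - v y) < r}"] conjI
            openin_seminorm_ball[OF V p]) (auto simp: dist_real_def abs_minus_commute)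
    qed
  qed
  moreover have "\<exists>C. openin ?T C \<and> (\<lambda>_. 0) \<in> C \<and> C \<subseteq> N \<and>
      (\<forall>u\<in>C. \<forall>v\<in>C. \<forall>t::real. 0 \<le> t \<and> t \<le> 1 \<longrightarrow> (\<lambda>y. t * u y + (1 - t) * v y) \<in> C)"
    if N: "nhd_in ?T (\<lambda>_. 0) N" for N
  proof -
    obtain W where W: "openin ?T W" "(\<lambda>_. 0) \<in> W" "W \<subseteq> N" using N by (auto simp: nhd_in_def)
    obtain e where e: "e > 0" "\<And>w. w \<in> V \<Longrightarrow> p w < e \<Longrightarrow> w \<in> W"
      by (rule openin_seminorm_topologyE[OF W(1,2), unfolded diff_0_right]) (rule that)
    have "(\<lambda>y. t * u y + (1 - t) * v y) \<in> {v \<in> V. p v < e}"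
      if uv: "u \<in> {v \<in> V. p v < e}" "v \<in> {v \<in> V. p v < e}" and t: "0 \<le> t" "t \<le> 1" for u v t
    proof -
      have "p (\<lambda>y. t * u y + (1 - t) * v y) \<le> p (\<lambda>y. t * u y) + p (\<lambda>y. (1 - t) * v y)"
        using uv by (intro seminorm_onD(1)[OF p] D) auto
      also have "\<dots> = t * p u + (1 - t) * p v"
        using uv t seminorm_onD(2)[OF p] by simp
      also have "\<dots> < e"
        using uv t by (intro convex_bound_lt) auto
      finally show ?thesis using uv D by simp
    qed
    then show ?thesis
      using e W openin_seminorm_ball[OF V p D(1), of e] seminorm_zero[OF V p]
      by (intro exI[of _ "{v \<in> V. p v < e}"]) (auto simp: D(1))
  qed
  ultimately show ?thesis by (simp add: lc_vector_topology_def)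
qed

section \<open>Neighbourhoods of zero in the free locally convex space\<close>

text \<open>The supremum of \<open>\<bar>pairing w f\<bar>\<close> over \<open>H\<close> is a
  seminorm: finite because \<open>w\<close> has finite support and \<open>H\<close> is pointwise
  bounded. Equicontinuity of \<open>H\<close> is continuity of \<open>L_delta\<close> for the
  topology of this seminorm, and the open unit ball lies in the polar.\<close>

lemma polar_open_neighbourhood:
  assumes eq: "equicontinuous_on X H"
    and bdd: "\<And>x. x \<in> topspace X \<Longrightarrow> \<exists>M. \<forall>f\<in>H. \<bar>f x\<bar> \<le> M"
  obtains T V where "lc_vector_topology (L_carrier X) T" "continuous_map X T L_delta"
    "openin T V" "(\<lambda>_. 0) \<in> V" "V \<subseteq> polar X H"
proof -
  obtain M where M: "\<And>x f. x \<in> topspace X \<Longrightarrow> f \<in> H \<Longrightarrow> \<bar>f x\<bar> \<le> M x"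
    using bdd by metis
  \<comment> \<open>Adding the zero function leaves the polar condition unchanged and avoids the
    supremum of an empty set of reals.\<close>
  define G where "G = insert (\<lambda>_. 0) H"
  define p where "p = (\<lambda>w. SUP f\<in>G. \<bar>pairing w f\<bar>)"
  note sub = L_carrier_subspace[of X]
  have bdd: "bdd_above ((\<lambda>f. \<bar>pairing w f\<bar>) ` G)" if w: "w \<in> L_carrier X" for w
  proof (rule bdd_aboveI2)
    fix f assume f: "f \<in> G"
    have "\<bar>pairing w f\<bar> \<le> (\<Sum>y | w y \<noteq> 0. \<bar>w y * f y\<bar>)"
      unfolding pairing_def by (rule sum_abs)
    also have "\<dots> \<le> (\<Sum>y | w y \<noteq> 0. \<bar>w y\<bar> * \<bar>M y\<bar>)"
    proof (rule sum_mono)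
      fix y assume "y \<in> {y. w y \<noteq> 0}"
      then have "y \<in> topspace X" using w by (auto simp: L_carrier_def)
      then have "\<bar>f y\<bar> \<le> \<bar>M y\<bar>" using f M[of y f] by (auto simp: G_def)
      then show "\<bar>w y * f y\<bar> \<le> \<bar>w y\<bar> * \<bar>M y\<bar>"
        by (simp add: abs_mult mult_left_mono)
    qed
    finally show "\<bar>pairing w f\<bar> \<le> (\<Sum>y | w y \<noteq> 0. \<bar>w y\<bar> * \<bar>M y\<bar>)" .
  qed
  have le: "\<bar>pairing w f\<bar> \<le> p w" if "w \<in> L_carrier X" "f \<in> G" for w f
    unfolding p_def using that by (intro cSUP_upper bdd)
  have least: "p w \<le> c" if "\<And>f. f \<in> G \<Longrightarrow> \<bar>pairing w f\<bar> \<le> c" for w c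
    unfolding p_def using that by (intro cSUP_least) (auto simp: G_def)
  have p: "seminorm_on (L_carrier X) p"
  proof (rule seminorm_onI[OF sub])
    fix u v assume uv: "u \<in> L_carrier X" "v \<in> L_carrier X"
    show "p (\<lambda>y. u y + v y) \<le> p u + p v"
    proof (rule least)
      fix f assume f: "f \<in> G"
      show "\<bar>pairing (\<lambda>y. u y + v y) f\<bar> \<le> p u + p v"
        using le[OF uv(1) f] le[OF uv(2) f] pairing_add[OF uv, of f] by linarith
    qed
  next
    fix c :: real and u assume u: "u \<in> L_carrier X"
    show "p (\<lambda>y. c * u y) \<le> \<bar>c\<bar> * p u"
      using le[OF u] by (intro least) (simp add: pairing_scale abs_mult mult_left_mono)
  qed
  let ?T = "seminorm_topology (L_carrier X) p"
  have "continuous_map X ?T L_delta"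
    unfolding continuous_map_def
  proof (intro conjI allI impI)
    show "L_delta \<in> topspace X \<rightarrow> topspace ?T" by simp
    fix U assume U: "openin ?T U"
    have "\<exists>W. openin X W \<and> x \<in> W \<and> W \<subseteq> {x \<in> topspace X. L_delta x \<in> U}"
      if x: "x \<in> {x \<in> topspace X. L_delta x \<in> U}" for x
    proof -
      have xU: "L_delta x \<in> U" and xX: "x \<in> topspace X" using x by auto
      obtain e where e: "e > 0"
        "\<And>v. v \<in> L_carrier X \<Longrightarrow> p (\<lambda>y. v y - L_delta x y) < e \<Longrightarrow> v \<in> U"
        by (rule openin_seminorm_topologyE[OF U xU]) (rule that)
      \<comment> \<open>A supremum of values below \<open>e/2\<close> is only at most
        \<open>e/2\<close>, hence the halved radius.\<close>
      obtain W where W: "openin X W" "x \<in> W" "\<And>f y. f \<in> H \<Longrightarrow> y \<in> W \<Longrightarrow> \<bar>f y - f x\<bar> < e/2"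
        using eq xX e(1) unfolding equicontinuous_on_def by (meson half_gt_zero)
      have "L_delta y \<in> U" if y: "y \<in> W" for y
      proof (rule e(2))
        have yX: "y \<in> topspace X" using W(1) y openin_subset by blast
        then show "L_delta y \<in> L_carrier X" by simp
        have "p (\<lambda>z. L_delta y z - L_delta x z) \<le> e/2"
          using W(3)[OF _ y] xX yX e(1)
          by (intro least) (auto simp: G_def pairing_diff[of _ X] less_imp_le)
        then show "p (\<lambda>z. L_delta y z - L_delta x z) < e" using e(1) by simp
      qed
      then show ?thesis using W(1,2) openin_subset[OF W(1)] by blast
    qed
    then show "openin X {x \<in> topspace X. L_delta x \<in> U}" by (subst openin_subopen) blast
  qed
  moreover have "openin ?T {v \<in> L_carrier X. p v < 1}"
    using openin_seminorm_ball[OF sub p L_carrier_closed(1), of 1] by simp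
  moreover have "{v \<in> L_carrier X. p v < 1} \<subseteq> polar X H"
    unfolding polar_def using le by (auto simp: G_def) (metis less_imp_le order_trans)
  ultimately show ?thesis
    using lc_vector_topology_seminorm[OF sub p] seminorm_zero[OF sub p]
    by (intro that[of ?T "{v \<in> L_carrier X. p v < 1}"]) (auto simp: L_carrier_closed(1))
qed

lemma openin_LfreeI:
  assumes "lc_vector_topology (L_carrier X) T" "continuous_map X T L_delta" "openin T U"
  shows "openin (Lfree X) U"
  unfolding Lfree_def by (rule topology_generated_by_Basis) (use assms in blast)

lemma topspace_Lfree [simp]: "topspace (Lfree X) = L_carrier X"
proof
  show "topspace (Lfree X) \<subseteq> L_carrier X"
    unfolding Lfree_def topology_generated_by_topspace
    by (auto simp: lc_vector_topology_def dest: openin_subset)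
  \<comment> \<open>The empty set of functions yields one admissible topology, so the generating
    union is not empty.\<close>
  obtain T where T: "lc_vector_topology (L_carrier X) T" "continuous_map X T L_delta"
    by (rule polar_open_neighbourhood[of X "{}"]) (auto simp: equicontinuous_on_def)
  have "openin T (L_carrier X)"
    using T(1) openin_topspace[of T] by (simp add: lc_vector_topology_def)
  from openin_subset[OF openin_LfreeI[OF T this]] show "L_carrier X \<subseteq> topspace (Lfree X)" .
qed

lemma nhd_in_Lfree_polar:
  assumes "equicontinuous_on X H" "\<And>x. x \<in> topspace X \<Longrightarrow> \<exists>M. \<forall>f\<in>H. \<bar>f x\<bar> \<le> M"
  shows "nhd_in (Lfree X) (\<lambda>_. 0) (polar X H)"
proof -
  obtain T V where "lc_vector_topology (L_carrier X) T" "continuous_map X T L_delta"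
    "openin T V" "(\<lambda>_. 0) \<in> V" "V \<subseteq> polar X H"
    by (rule polar_open_neighbourhood[OF assms])
  then show ?thesis
    unfolding nhd_in_def topspace_Lfree by (auto simp: polar_def intro: openin_LfreeI)
qed

text \<open>These properties are all that the bipolar argument uses of a neighbourhood of zero. They
  mention no topology on L(X) and pass to intersections, so Lfree itself need not be shown to be a
  vector topology.\<close>

definition L_disc :: "'a topology \<Rightarrow> ('a \<Rightarrow> real) set \<Rightarrow> bool" where
  "L_disc X D \<longleftrightarrow> D \<subseteq> L_carrier X \<and> (\<lambda>_. 0) \<in> D \<and>
     (\<forall>u\<in>D. \<forall>v\<in>D. \<forall>t. 0 \<le> t \<and> t \<le> 1 \<longrightarrow> (\<lambda>y. t * u y + (1 - t) * v y) \<in> D) \<and>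
     (\<forall>u\<in>D. (\<lambda>y. - u y) \<in> D) \<and>
     (\<forall>u\<in>L_carrier X. \<exists>c>0. (\<lambda>y. c * u y) \<in> D) \<and>
     (\<forall>x\<in>topspace X. \<forall>c. \<exists>W. openin X W \<and> x \<in> W \<and>
        (\<forall>y\<in>W. (\<lambda>z. c * (L_delta y z - L_delta x z)) \<in> D))"

lemma L_disc_convex:
  assumes "L_disc X D" "u \<in> D" "v \<in> D" "0 \<le> t" "t \<le> 1"
  shows "(\<lambda>y. t * u y + (1 - t) * v y) \<in> D"
  using assms unfolding L_disc_def by blast

lemma L_disc_shrink:
  assumes "L_disc X D" "u \<in> D" "0 \<le> t" "t \<le> 1"
  shows "(\<lambda>y. t * u y) \<in> D"
  using L_disc_convex[OF assms(1,2) _ assms(3,4), of "\<lambda>_. 0"] assms(1) by (simp add: L_disc_def)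

lemma L_disc_Int:
  assumes D: "L_disc X D" and E: "L_disc X E"
  shows "L_disc X (D \<inter> E)"
  unfolding L_disc_def
proof (intro conjI ballI allI impI)
  fix u assume u: "u \<in> L_carrier X"
  obtain c d where c: "c > 0" "(\<lambda>y. c * u y) \<in> D" and d: "d > 0" "(\<lambda>y. d * u y) \<in> E"
    using D E u unfolding L_disc_def by meson
  have "(\<lambda>y. min c d * u y) \<in> D"
    using L_disc_shrink[OF D c(2), of "min c d / c"] c(1) d(1) by simp
  moreover have "(\<lambda>y. min c d * u y) \<in> E"
    using L_disc_shrink[OF E d(2), of "min c d / d"] c(1) d(1) by simp
  ultimately show "\<exists>c>0. (\<lambda>y. c * u y) \<in> D \<inter> E"
    using c(1) d(1) by (intro exI[of _ "min c d"]) simp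
next
  fix x c assume x: "x \<in> topspace X"
  obtain W1 where "openin X W1" "x \<in> W1" "\<forall>y\<in>W1. (\<lambda>z. c * (L_delta y z - L_delta x z)) \<in> D"
    using D x unfolding L_disc_def by meson
  moreover obtain W2 where
    "openin X W2" "x \<in> W2" "\<forall>y\<in>W2. (\<lambda>z. c * (L_delta y z - L_delta x z)) \<in> E"
    using E x unfolding L_disc_def by meson
  ultimately show "\<exists>W. openin X W \<and> x \<in> W \<and> (\<forall>y\<in>W. (\<lambda>z. c * (L_delta y z - L_delta x z)) \<in> D \<inter> E)"
    by (intro exI[of _ "W1 \<inter> W2"]) auto
qed (use D E in \<open>auto simp: L_disc_def\<close>)

text \<open>A convex open neighbourhood is intersected with its reflection to become symmetric. It
  absorbs \<open>u\<close> because scaling is continuous in the scalar at 0, and the clause on point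
  masses is continuity of \<open>y \<mapsto> c (L_delta y - L_delta x)\<close> at \<open>x\<close>,
  where the value is 0.\<close>

lemma vector_topology_contains_L_disc:
  assumes T: "lc_vector_topology (L_carrier X) T" and d: "continuous_map X T L_delta"
    and U: "openin T U" "(\<lambda>_. 0) \<in> U"
  obtains D where "L_disc X D" "D \<subseteq> U"
proof -
  have top: "topspace T = L_carrier X"
    and add: "continuous_map (prod_topology T T) T (\<lambda>(u, v). (\<lambda>y. u y + v y))"
    and scale: "continuous_map (prod_topology euclideanreal T) T (\<lambda>(c, v). (\<lambda>y. c * v y))"
    using T by (auto simp: lc_vector_topology_def)
  have "nhd_in T (\<lambda>_. 0) U" using U openin_subset by (auto simp: nhd_in_def)
  then obtain C where C: "openin T C" "(\<lambda>_. 0) \<in> C" "C \<subseteq> U"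
    and conv: "\<And>u v t. u \<in> C \<Longrightarrow> v \<in> C \<Longrightarrow> 0 \<le> t \<Longrightarrow> t \<le> 1 \<Longrightarrow> (\<lambda>y. t * u y + (1 - t) * v y) \<in> C"
    using T unfolding lc_vector_topology_def by meson
  have scale_const: "continuous_map T T (\<lambda>v y. c * v y)" for c
    using continuous_map_compose[OF continuous_map_pairedI[OF _ continuous_map_id] scale,
        of "\<lambda>_. c"] by (simp add: o_def)
  define D where "D = C \<inter> {u \<in> L_carrier X. (\<lambda>y. - u y) \<in> C}"
  have D: "openin T D"
  proof -
    have "openin T {u \<in> topspace T. (\<lambda>y. -1 * u y) \<in> C}"
      by (rule openin_continuous_map_preimage[OF scale_const C(1)])
    then show ?thesis unfolding D_def using C(1) top by (simp add: openin_Int)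
  qed
  have D0: "(\<lambda>_. 0) \<in> D" using C(2) by (simp add: D_def L_carrier_closed)
  have "L_disc X D"
    unfolding L_disc_def
  proof (intro conjI ballI allI impI)
    show "D \<subseteq> L_carrier X" by (auto simp: D_def)
    show "(\<lambda>_. 0) \<in> D" by (rule D0)
    show "(\<lambda>y. - u y) \<in> D" if "u \<in> D" for u
      using that by (auto simp: D_def L_carrier_closed)
    show "(\<lambda>y. t * u y + (1 - t) * v y) \<in> D" if "u \<in> D" "v \<in> D" "0 \<le> t \<and> t \<le> 1" for u v t
    proof -
      have "(\<lambda>y. t * - u y + (1 - t) * - v y) \<in> C" "(\<lambda>y. t * u y + (1 - t) * v y) \<in> C"
        using that conv[of u v t] conv[of "\<lambda>y. - u y" "\<lambda>y. - v y" t] by (simp_all add: D_def)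
      moreover have "(\<lambda>y. t * u y + (1 - t) * v y) \<in> L_carrier X"
        using that by (intro L_carrier_closed) (auto simp: D_def)
      moreover have "(\<lambda>y. t * - u y + (1 - t) * - v y) = (\<lambda>y. - (t * u y + (1 - t) * v y))"
        by (simp add: algebra_simps)
      ultimately show ?thesis unfolding D_def by simp
    qed
  next
    fix u assume u: "u \<in> L_carrier X"
    have "continuous_map euclideanreal T (\<lambda>c y. c * u y)"
      using continuous_map_compose[OF continuous_map_pairedI[OF continuous_map_id] scale,
          of "\<lambda>_. u"] u top by (simp add: o_def)
    from openin_continuous_map_preimage[OF this D]
    have "open {c. (\<lambda>y. c * u y) \<in> D}" by simp
    then obtain e where "e > 0" and e: "ball 0 e \<subseteq> {c. (\<lambda>y. c * u y) \<in> D}"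
      using D0 by (elim openE[where x = 0]) simp_all
    have "e/2 \<in> ball 0 e" using \<open>e > 0\<close> by simp
    with e have "(\<lambda>y. e/2 * u y) \<in> D" by blast
    then show "\<exists>c>0. (\<lambda>y. c * u y) \<in> D" using half_gt_zero[OF \<open>e > 0\<close>] by blast
  next
    fix x c assume x: "x \<in> topspace X"
    have "continuous_map X T (\<lambda>y z. L_delta y z + - L_delta x z)"
      using continuous_map_compose[OF continuous_map_pairedI[OF d] add,
          of "\<lambda>_ z. - L_delta x z"] x top L_carrier_closed(4)[of "L_delta x" X] by (simp add: o_def)
    from continuous_map_compose[OF this scale_const, of c]
    have cont: "continuous_map X T (\<lambda>y z. c * (L_delta y z - L_delta x z))" by (simp add: o_def)
    show "\<exists>W. openin X W \<and> x \<in> W \<and> (\<forall>y\<in>W. (\<lambda>z. c * (L_delta y z - L_delta x z)) \<in> D)"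
      using openin_continuous_map_preimage[OF cont D] x D0
      by (intro exI[of _ "{y \<in> topspace X. (\<lambda>z. c * (L_delta y z - L_delta x z)) \<in> D}"]) auto
  qed
  then show ?thesis using C(3) that[of D] by (auto simp: D_def)
qed

text \<open>An open set of \<open>Lfree\<close> may combine open sets of different topologies. Each
  of these contains a disc around zero, and closure of discs under intersection handles the
  combination.\<close>

lemma nhd_in_Lfree_contains_L_disc:
  assumes "nhd_in (Lfree X) (\<lambda>_. 0) N"
  obtains D where "L_disc X D" "D \<subseteq> N"
proof -
  obtain U where U: "openin (Lfree X) U" "(\<lambda>_. 0) \<in> U" "U \<subseteq> N"
    using assms by (auto simp: nhd_in_def)
  from U(1) have "generate_topology_on (\<Union>{{U. openin T U} | T.
      lc_vector_topology (L_carrier X) T \<and> continuous_map X T L_delta}) U"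
    by (simp add: Lfree_def openin_topology_generated_by_iff)
  then have "\<exists>D. L_disc X D \<and> D \<subseteq> U" using U(2)
  proof (induction rule: generate_topology_on.induct)
    case Empty
    then show ?case by simp
  next
    case (Int a b)
    then obtain D E where "L_disc X D" "D \<subseteq> a" "L_disc X E" "E \<subseteq> b" by blast
    then show ?case using L_disc_Int by (intro exI[of _ "D \<inter> E"]) auto
  next
    case (UN \<K>)
    then show ?case by (meson Union_iff Union_upper order_trans)
  next
    case (Basis s)
    then obtain T where "lc_vector_topology (L_carrier X) T" "continuous_map X T L_delta" "openin T s"
      by blast
    with Basis show ?case using vector_topology_contains_L_disc by metis
  qed
  then show ?thesis using U(3) that by blast
qed

text \<open>The witness is the Minkowski functional of \<open>D\<close>.\<close>

lemma L_disc_seminorm: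
  assumes D: "L_disc X D"
  obtains p where "seminorm_on (L_carrier X) p"
    "\<And>u. u \<in> L_carrier X \<Longrightarrow> p u < 1 \<Longrightarrow> u \<in> D"
    "\<And>u c. u \<in> L_carrier X \<Longrightarrow> c > 0 \<Longrightarrow> (\<lambda>y. c * u y) \<in> D \<Longrightarrow> p u \<le> inverse c"
proof -
  define S where "S = (\<lambda>u. {s. s > 0 \<and> (\<lambda>y. inverse s * u y) \<in> D})"
  define p where "p = (\<lambda>u. Inf (S u))"
  have ne: "S u \<noteq> {}" if "u \<in> L_carrier X" for u
  proof -
    obtain c where "c > 0" "(\<lambda>y. c * u y) \<in> D" using D \<open>u \<in> L_carrier X\<close> by (auto simp: L_disc_def)
    then have "inverse c \<in> S u" by (simp add: S_def)
    then show ?thesis by blast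
  qed
  have le: "p u \<le> s" if "s \<in> S u" for u s
    unfolding p_def using that by (intro cInf_lower bdd_belowI[of _ 0]) (auto simp: S_def)
  have ge: "b \<le> p u" if "u \<in> L_carrier X" "\<And>s. s \<in> S u \<Longrightarrow> b \<le> s" for u b
    unfolding p_def using that ne by (intro cInf_greatest) auto
  \<comment> \<open>The vector \<open>(u + v) / (s + t)\<close> is the convex combination of
    \<open>u / s\<close> and \<open>v / t\<close> with weights \<open>s / (s + t)\<close> and
    \<open>t / (s + t)\<close>.\<close>
  have S_add: "s + t \<in> S (\<lambda>y. u y + v y)" if s: "s \<in> S u" and t: "t \<in> S v" for s t u v
  proof -
    have pos: "s > 0" "t > 0" using s t by (auto simp: S_def)
    define r where "r = s / (s + t)"
    have "(\<lambda>y. r * (inverse s * u y) + (1 - r) * (inverse t * v y)) \<in> D"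
      using s t pos by (intro L_disc_convex[OF D]) (auto simp: S_def r_def)
    moreover have "r * (inverse s * a) + (1 - r) * (inverse t * b) = inverse (s + t) * (a + b)" for a b
    proof -
      have "r * inverse s = inverse (s + t)" "(1 - r) * inverse t = inverse (s + t)"
        using pos unfolding r_def by (auto simp: field_simps)
      then show ?thesis by (metis distrib_left mult.assoc)
    qed
    ultimately show ?thesis using pos by (simp add: S_def)
  qed
  \<comment> \<open>Symmetry of the disc absorbs the sign of \<open>c\<close>.\<close>
  have S_scale: "\<bar>c\<bar> * s \<in> S (\<lambda>y. c * u y)" if s: "s \<in> S u" and c: "c \<noteq> 0" for s c u
  proof -
    have s: "s > 0" "(\<lambda>y. inverse s * u y) \<in> D" using s by (auto simp: S_def)
    then have "(\<lambda>y. - (inverse s * u y)) \<in> D" using D by (auto simp: L_disc_def)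
    with s have "(\<lambda>y. inverse (\<bar>c\<bar> * s) * (c * u y)) \<in> D"
      using c by (cases "c > 0") (simp_all add: field_simps)
    then show ?thesis using s c by (simp add: S_def)
  qed
  have zero: "p (\<lambda>_. 0) \<le> 0"
  proof (rule field_le_epsilon)
    fix e :: real assume "e > 0"
    then show "p (\<lambda>_. 0) \<le> 0 + e" using D by (intro le) (auto simp: S_def L_disc_def)
  qed
  have seminorm: "seminorm_on (L_carrier X) p"
  proof (rule seminorm_onI[OF L_carrier_subspace])
    fix u v assume uv: "u \<in> L_carrier X" "v \<in> L_carrier X"
    have "p (\<lambda>y. u y + v y) - s \<le> p v" if s: "s \<in> S u" for s
    proof (rule ge[OF uv(2)])
      fix t assume "t \<in> S v"
      from le[OF S_add[OF s this]] show "p (\<lambda>y. u y + v y) - s \<le> t" by simp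
    qed
    then have "p (\<lambda>y. u y + v y) - p v \<le> p u" by (intro ge uv) (simp add: algebra_simps)
    then show "p (\<lambda>y. u y + v y) \<le> p u + p v" by simp
  next
    fix c :: real and u assume u: "u \<in> L_carrier X"
    show "p (\<lambda>y. c * u y) \<le> \<bar>c\<bar> * p u"
    proof (cases "c = 0")
      case True
      then show ?thesis using zero by simp
    next
      case False
      have "p (\<lambda>y. c * u y) / \<bar>c\<bar> \<le> p u"
        using le[OF S_scale[OF _ False]] False by (intro ge u) (simp add: field_simps)
      then show ?thesis using False by (simp add: field_simps)
    qed
  qed
  have mem: "u \<in> D" if u: "u \<in> L_carrier X" "p u < 1" for u
  proof -
    \<comment> \<open>An infimum below 1 yields \<open>s < 1\<close> with \<open>u / s\<close> in
      the disc; shrinking by \<open>s\<close> returns \<open>u\<close>.\<close>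
    obtain s where s: "s \<in> S u" "s < 1" using ge[OF u(1), of 1] u(2) by force
    then have "(\<lambda>y. s * (inverse s * u y)) \<in> D"
      using L_disc_shrink[OF D, of "\<lambda>y. inverse s * u y" s] by (auto simp: S_def)
    moreover have "(\<lambda>y. s * (inverse s * u y)) = u" using s by (auto simp: S_def)
    ultimately show ?thesis by simp
  qed
  have "p u \<le> inverse c" if "u \<in> L_carrier X" "c > 0" "(\<lambda>y. c * u y) \<in> D" for u c
    using that by (intro le) (simp add: S_def)
  with seminorm mem show ?thesis by (rule that)
qed

text \<open>The bipolar argument: \<open>H\<close> consists of the functionals dominated by twice
  the gauge \<open>p\<close> of a disc inside \<open>N\<close>. The disc contains scaled differences
  of nearby point masses, which makes \<open>H\<close> equicontinuous; Hahn-Banach supplies enough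
  members of \<open>H\<close> to bring its polar back into the disc.\<close>

theorem nhd_in_Lfree_contains_polar:
  assumes N: "nhd_in (Lfree X) (\<lambda>_. 0) N"
  obtains H where "H \<subseteq> Ck_carrier X" "equicontinuous_on X H"
    "\<And>x. x \<in> topspace X \<Longrightarrow> \<exists>M. \<forall>f\<in>H. \<bar>f x\<bar> \<le> M" "polar X H \<subseteq> N"
proof -
  obtain D where D: "L_disc X D" "D \<subseteq> N" by (rule nhd_in_Lfree_contains_L_disc[OF N])
  obtain p where p: "seminorm_on (L_carrier X) p"
    and pD: "\<And>u. u \<in> L_carrier X \<Longrightarrow> p u < 1 \<Longrightarrow> u \<in> D"
    and Dp: "\<And>u c. u \<in> L_carrier X \<Longrightarrow> c > 0 \<Longrightarrow> (\<lambda>y. c * u y) \<in> D \<Longrightarrow> p u \<le> inverse c"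
    by (rule L_disc_seminorm[OF D(1)]) (rule that)
  \<comment> \<open>The Hahn-Banach function attaining \<open>p u\<close> may be doubled within
    \<open>H\<close>. On the polar this gives \<open>2 * p u \<le> 1\<close>, hence the strict
    \<open>p u < 1\<close> that membership in the disc requires.\<close>
  define H where "H = {f. (\<forall>x. x \<notin> topspace X \<longrightarrow> f x = 0) \<and>
    (\<forall>u\<in>L_carrier X. \<bar>pairing u f\<bar> \<le> 2 * p u)}"
  have eq: "equicontinuous_on X H"
    unfolding equicontinuous_on_def
  proof (intro ballI allI impI)
    fix x and e :: real assume x: "x \<in> topspace X" and e: "e > 0"
    \<comment> \<open>The multiplier \<open>3 / e\<close> bounds the gauge of the difference by
      \<open>e / 3\<close>, and the factor 2 in \<open>H\<close> still leaves less than
      \<open>e\<close>.\<close>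
    obtain W where W: "openin X W" "x \<in> W"
      "\<And>y. y \<in> W \<Longrightarrow> (\<lambda>z. 3 / e * (L_delta y z - L_delta x z)) \<in> D"
      using D(1) x unfolding L_disc_def by meson
    have "\<bar>f y - f x\<bar> < e" if f: "f \<in> H" and y: "y \<in> W" for f y
    proof -
      have yX: "y \<in> topspace X" using W(1) y openin_subset by blast
      have d: "(\<lambda>z. L_delta y z - L_delta x z) \<in> L_carrier X"
        using x yX by (intro L_carrier_closed) auto
      have "\<bar>f y - f x\<bar> \<le> 2 * p (\<lambda>z. L_delta y z - L_delta x z)"
        using f d x yX pairing_diff[of "L_delta y" X "L_delta x" f] by (auto simp: H_def)
      also have "\<dots> \<le> 2 * (e / 3)"
        using Dp[OF d _ W(3)[OF y]] e by simp
      finally show ?thesis using e by simp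
    qed
    then show "\<exists>W. openin X W \<and> x \<in> W \<and> (\<forall>f\<in>H. \<forall>y\<in>W. \<bar>f y - f x\<bar> < e)"
      using W(1,2) by blast
  qed
  have bdd: "\<exists>M. \<forall>f\<in>H. \<bar>f x\<bar> \<le> M" if "x \<in> topspace X" for x
  proof (intro exI ballI)
    fix f assume "f \<in> H"
    then have "\<forall>u\<in>L_carrier X. \<bar>pairing u f\<bar> \<le> 2 * p u" by (simp add: H_def)
    from bspec[OF this, of "L_delta x"] that show "\<bar>f x\<bar> \<le> 2 * p (L_delta x)" by simp
  qed
  have "H \<subseteq> Ck_carrier X"
  proof
    fix f assume f: "f \<in> H"
    have "continuous_map X euclideanreal f"
      by (rule equicontinuous_on_imp_continuous_map[OF eq f])
    then show "f \<in> Ck_carrier X" using f by (simp add: Ck_carrier_def H_def)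
  qed
  moreover have "polar X H \<subseteq> N"
  proof
    fix u assume u: "u \<in> polar X H"
    then have uL: "u \<in> L_carrier X" by (simp add: polar_def)
    obtain f where f: "\<And>x. x \<notin> topspace X \<Longrightarrow> f x = 0"
      "\<And>v. v \<in> L_carrier X \<Longrightarrow> \<bar>pairing v f\<bar> \<le> p v" "pairing u f = p u"
      by (rule L_carrier_hahn_banach[OF p uL]) (rule that)
    have "(\<lambda>y. 2 * f y) \<in> H"
      using f(1,2) by (simp add: H_def pairing_scale_right abs_mult)
    then have "\<bar>2 * p u\<bar> \<le> 1"
      using u f(3) pairing_scale_right[of u 2 f] by (force simp: polar_def)
    then show "u \<in> N" using pD[OF uL] D(2) by auto
  qed
  ultimately show ?thesis by (intro that[OF _ eq bdd])
qed

section \<open>Bases and resolutions\<close>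

lemma continuous_map_Ck_pairing:
  assumes "\<mu> \<in> L_carrier X"
  shows "continuous_map (Ck X) euclideanreal (pairing \<mu>)"
  unfolding pairing_def
  by (intro continuous_map_sum continuous_map_real_mult_left continuous_map_Ck_eval)
    (use assms in \<open>auto simp: L_carrier_def\<close>)

text \<open>Since \<open>U\<close> contains the polar of some equicontinuous, pointwise bounded
  \<open>H\<close>, it contains suitably scaled point masses and differences of point masses.
  Testing against these transfers the bounds and moduli of continuity of \<open>H\<close> to the
  whole polar of \<open>U\<close>, which is therefore a closed subset of a compact set.\<close>

lemma compactin_polar_of_nhd:
  assumes U: "nhd_in (Lfree X) (\<lambda>_. 0) U"
  shows "compactin (Ck X) {f \<in> Ck_carrier X. \<forall>\<mu>\<in>U. \<bar>pairing \<mu> f\<bar> \<le> 1}" (is "compactin _ ?K")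
proof -
  obtain H where eq: "equicontinuous_on X H"
    and bdd: "\<And>x. x \<in> topspace X \<Longrightarrow> \<exists>M. \<forall>f\<in>H. \<bar>f x\<bar> \<le> M" and HU: "polar X H \<subseteq> U"
    by (rule nhd_in_Lfree_contains_polar[OF U]) (rule that)
  have UL: "U \<subseteq> L_carrier X" and U0: "U \<noteq> {}" using U by (auto simp: nhd_in_def)
  have "equicontinuous_on X ?K"
    unfolding equicontinuous_on_def
  proof (intro ballI allI impI)
    fix x and e :: real assume x: "x \<in> topspace X" and e: "e > 0"
    obtain W where W: "openin X W" "x \<in> W" and HW: "\<forall>f\<in>H. \<forall>y\<in>W. \<bar>f y - f x\<bar> < e/2"
      using eq x half_gt_zero[OF e] unfolding equicontinuous_on_def by meson
    have "\<bar>f y - f x\<bar> < e" if f: "f \<in> ?K" and y: "y \<in> W" for f y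
    proof -
      \<comment> \<open>The scaling turns the polar bound 1 into the oscillation bound
        \<open>e/2\<close>.\<close>
      let ?w = "\<lambda>z. 2/e * (L_delta y z - L_delta x z)"
      have yX: "y \<in> topspace X" using W(1) y openin_subset by blast
      have "pairing ?w g = 2/e * (g y - g x)" for g
        using pairing_scale[of "2/e" "\<lambda>z. L_delta y z - L_delta x z" g]
          pairing_diff[of "L_delta y" X "L_delta x" g] x yX by simp
      moreover have "\<bar>2/e * a\<bar> \<le> 1 \<longleftrightarrow> \<bar>a\<bar> \<le> e/2" for a
        using e by (simp add: abs_mult field_simps)
      ultimately have pair: "\<bar>pairing ?w g\<bar> \<le> 1 \<longleftrightarrow> \<bar>g y - g x\<bar> \<le> e/2" for g
        by (simp only:)
      have "?w \<in> L_carrier X" using x yX by (intro L_carrier_closed) auto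
      moreover have "\<bar>pairing ?w g\<bar> \<le> 1" if "g \<in> H" for g
        using HW that y e unfolding pair by (simp add: less_imp_le)
      ultimately have "?w \<in> U" using HU by (auto simp: polar_def)
      then have "\<bar>pairing ?w f\<bar> \<le> 1" using f by blast
      then show ?thesis using e unfolding pair by simp
    qed
    then show "\<exists>W. openin X W \<and> x \<in> W \<and> (\<forall>f\<in>?K. \<forall>y\<in>W. \<bar>f y - f x\<bar> < e)"
      using W by (intro exI[of _ W] conjI ballI) auto
  qed
  moreover have "\<exists>M. \<forall>f\<in>?K. \<bar>f x\<bar> \<le> M" if x: "x \<in> topspace X" for x
  proof -
    obtain M where M: "\<forall>f\<in>H. \<bar>f x\<bar> \<le> M" using bdd[OF x] by blast
    \<comment> \<open>The bound \<open>M\<close> may be 0, and negative if \<open>H\<close> is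
      empty, so \<open>\<bar>M\<bar> + 1\<close> serves as a positive substitute.\<close>
    let ?c = "inverse (\<bar>M\<bar> + 1)"
    let ?w = "\<lambda>z. ?c * L_delta x z"
    have pair: "pairing ?w g = ?c * g x" for g using pairing_scale[of ?c "L_delta x" g] by simp
    have "?w \<in> L_carrier X" using x by (intro L_carrier_closed) auto
    moreover have "\<bar>pairing ?w g\<bar> \<le> 1" if "g \<in> H" for g
    proof -
      have "\<bar>g x\<bar> \<le> \<bar>M\<bar> + 1" using M that by force
      then show ?thesis unfolding pair by (simp add: abs_mult field_simps)
    qed
    ultimately have "?w \<in> U" using HU by (auto simp: polar_def)
    then have "\<bar>pairing ?w f\<bar> \<le> 1" if "f \<in> ?K" for f using that by blast
    then have "\<bar>f x\<bar> \<le> \<bar>M\<bar> + 1" if "f \<in> ?K" for f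
      using that unfolding pair by (simp add: abs_mult field_simps)
    then show ?thesis by blast
  qed
  ultimately obtain E where E: "compactin (Ck X) E" "?K \<subseteq> E"
    using arzela_ascoli_Ck[of ?K X] by blast
  have "closedin (Ck X) {f \<in> topspace (Ck X). pairing \<mu> f \<in> {-1..1}}" if "\<mu> \<in> U" for \<mu>
    using that UL by (intro closedin_continuous_map_preimage[OF continuous_map_Ck_pairing]) auto
  then have "closedin (Ck X) (\<Inter>\<mu>\<in>U. {f \<in> topspace (Ck X). pairing \<mu> f \<in> {-1..1}})"
    using U0 by (intro closedin_Inter) auto
  also have "(\<Inter>\<mu>\<in>U. {f \<in> topspace (Ck X). pairing \<mu> f \<in> {-1..1}}) = ?K"
    using U0 by (auto simp: abs_le_iff)
  finally show ?thesis by (rule closed_compactin[OF E])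
qed

text \<open>Polars of the base sets form the resolution. The Ascoli property makes the polar of a
  compact \<open>C\<close> a neighbourhood; a base set inside it has a polar containing
  \<open>C\<close>. Covering is the case of singletons.\<close>

lemma G_base_Lfree_imp_compact_resolution:
  assumes X: "ascoli_space X" and G: "G_base (Lfree X) (\<lambda>_. 0)"
  shows "fundamental_compact_resolution (Ck X)"
proof -
  obtain U :: "(nat \<Rightarrow> nat) \<Rightarrow> ('a \<Rightarrow> real) set" where U: "\<And>\<alpha>. nhd_in (Lfree X) (\<lambda>_. 0) (U \<alpha>)"
    and mono: "\<And>\<alpha> \<beta>. \<beta> \<le> \<alpha> \<Longrightarrow> U \<alpha> \<subseteq> U \<beta>"
    and base: "\<And>N. nhd_in (Lfree X) (\<lambda>_. 0) N \<Longrightarrow> \<exists>\<alpha>. U \<alpha> \<subseteq> N"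
    using G unfolding G_base_def by metis
  define K where "K = (\<lambda>\<alpha>. {f \<in> Ck_carrier X. \<forall>\<mu>\<in>U \<alpha>. \<bar>pairing \<mu> f\<bar> \<le> 1})"
  have K: "compactin (Ck X) (K \<alpha>)" for \<alpha>
    unfolding K_def by (rule compactin_polar_of_nhd[OF U])
  have swallow: "\<exists>\<alpha>. C \<subseteq> K \<alpha>" if C: "compactin (Ck X) C" for C
  proof -
    have "nhd_in (Lfree X) (\<lambda>_. 0) (polar X C)"
      using X C compactin_Ck_pointwise_bounded[OF C]
      by (intro nhd_in_Lfree_polar) (auto simp: ascoli_space_def)
    then obtain \<alpha> where "U \<alpha> \<subseteq> polar X C" using base by blast
    moreover have "C \<subseteq> Ck_carrier X" using compactin_subset_topspace[OF C] by simp
    ultimately have "C \<subseteq> K \<alpha>" by (auto simp: K_def polar_def)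
    then show ?thesis by blast
  qed
  have "(\<Union>\<alpha>. K \<alpha>) = topspace (Ck X)"
  proof
    show "(\<Union>\<alpha>. K \<alpha>) \<subseteq> topspace (Ck X)" by (auto simp: K_def)
    show "topspace (Ck X) \<subseteq> (\<Union>\<alpha>. K \<alpha>)"
    proof
      fix f assume "f \<in> topspace (Ck X)"
      then have "compactin (Ck X) {f}" by simp
      from swallow[OF this] show "f \<in> (\<Union>\<alpha>. K \<alpha>)" by auto
    qed
  qed
  moreover have "K \<alpha> \<subseteq> K \<beta>" if "\<alpha> \<le> \<beta>" for \<alpha> \<beta>
    using mono[OF that] by (auto simp: K_def)
  ultimately show ?thesis
    unfolding fundamental_compact_resolution_def using K swallow by (intro exI[of _ K]) blast
qed

text \<open>Polars of the resolution form the base. A given neighbourhood contains the polar of an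
  equicontinuous set, which Arzela-Ascoli places inside a compact set and hence inside some
  \<open>K \<alpha>\<close>.\<close>

lemma compact_resolution_imp_G_base_Lfree:
  assumes X: "ascoli_space X" and R: "fundamental_compact_resolution (Ck X)"
  shows "G_base (Lfree X) (\<lambda>_. 0)"
proof -
  obtain K :: "(nat \<Rightarrow> nat) \<Rightarrow> ('a \<Rightarrow> real) set" where K: "\<And>\<alpha>. compactin (Ck X) (K \<alpha>)"
    and mono: "\<And>\<alpha> \<beta>. \<alpha> \<le> \<beta> \<Longrightarrow> K \<alpha> \<subseteq> K \<beta>"
    and swallow: "\<And>C. compactin (Ck X) C \<Longrightarrow> \<exists>\<alpha>. C \<subseteq> K \<alpha>"
    using R unfolding fundamental_compact_resolution_def by metis
  have "nhd_in (Lfree X) (\<lambda>_. 0) (polar X (K \<alpha>))" for \<alpha>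
    using X K compactin_Ck_pointwise_bounded[OF K]
    by (intro nhd_in_Lfree_polar) (auto simp: ascoli_space_def)
  moreover have "polar X (K \<alpha>) \<subseteq> polar X (K \<beta>)" if "\<beta> \<le> \<alpha>" for \<alpha> \<beta>
    by (rule polar_antimono[OF mono[OF that]])
  moreover have "\<exists>\<alpha>. polar X (K \<alpha>) \<subseteq> N" if N: "nhd_in (Lfree X) (\<lambda>_. 0) N" for N
  proof -
    obtain H where H: "H \<subseteq> Ck_carrier X" "equicontinuous_on X H"
      "\<And>x. x \<in> topspace X \<Longrightarrow> \<exists>M. \<forall>f\<in>H. \<bar>f x\<bar> \<le> M" and HN: "polar X H \<subseteq> N"
      by (rule nhd_in_Lfree_contains_polar[OF N]) (rule that)
    obtain E where "compactin (Ck X) E" "H \<subseteq> E" by (rule arzela_ascoli_Ck[OF H])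
    then obtain \<alpha> where "H \<subseteq> K \<alpha>" using swallow by blast
    then have "polar X (K \<alpha>) \<subseteq> N" using polar_antimono HN by blast
    then show ?thesis by blast
  qed
  ultimately show ?thesis
    unfolding G_base_def by (intro exI[of _ "\<lambda>\<alpha>. polar X (K \<alpha>)"]) blast
qed

section \<open>Exchange between compact sets of a space and neighbourhoods in its function
  space\<close>

lemma compact_resolution_imp_G_base_Ck:
  assumes R: "fundamental_compact_resolution Z"
  shows "G_base (Ck Z) (\<lambda>_. 0)"
proof -
  obtain K :: "(nat \<Rightarrow> nat) \<Rightarrow> 'a set" where K: "\<And>\<alpha>. compactin Z (K \<alpha>)"
    and mono: "\<And>\<alpha> \<beta>. \<alpha> \<le> \<beta> \<Longrightarrow> K \<alpha> \<subseteq> K \<beta>"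
    and swallow: "\<And>C. compactin Z C \<Longrightarrow> \<exists>\<alpha>. C \<subseteq> K \<alpha>"
    using R unfolding fundamental_compact_resolution_def by metis
  \<comment> \<open>The value \<open>\<alpha> 0\<close> also encodes the radius. Raising it shrinks
    the radius and, by monotonicity, only enlarges the compact set, so both requirements can be met
    by one index.\<close>
  define U where "U = (\<lambda>\<alpha>. {f \<in> Ck_carrier Z. \<forall>z\<in>K \<alpha>. \<bar>f z\<bar> \<le> inverse (real (Suc (\<alpha> 0)))})"
  have "nhd_in (Ck Z) (\<lambda>_. 0) (U \<alpha>)" for \<alpha>
    unfolding nhd_in_Ck_zero_iff
    by (intro conjI exI[of _ "K \<alpha>"] exI[of _ "inverse (real (Suc (\<alpha> 0)))"] K)
      (auto simp: U_def less_imp_le)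
  moreover have "U \<alpha> \<subseteq> U \<beta>" if le: "\<beta> \<le> \<alpha>" for \<alpha> \<beta>
  proof -
    have "inverse (real (Suc (\<alpha> 0))) \<le> inverse (real (Suc (\<beta> 0)))"
      using le by (simp add: le_fun_def)
    moreover have "\<bar>f z\<bar> \<le> inverse (real (Suc (\<alpha> 0)))" if "f \<in> U \<alpha>" "z \<in> K \<beta>" for f z
      using that mono[OF le] by (auto simp: U_def)
    ultimately have "\<bar>f z\<bar> \<le> inverse (real (Suc (\<beta> 0)))" if "f \<in> U \<alpha>" "z \<in> K \<beta>" for f z
      using that order_trans by blast
    then show ?thesis by (auto simp: U_def)
  qed
  moreover have "\<exists>\<alpha>. U \<alpha> \<subseteq> N" if N: "nhd_in (Ck Z) (\<lambda>_. 0) N" for N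
  proof -
    obtain C e where C: "compactin Z C" and e: "e > 0"
      and CN: "{g \<in> Ck_carrier Z. \<forall>x\<in>C. \<bar>g x\<bar> < e} \<subseteq> N"
      using N unfolding nhd_in_Ck_zero_iff by blast
    obtain \<alpha> where \<alpha>: "C \<subseteq> K \<alpha>" using swallow[OF C] ..
    obtain n where n: "inverse (real (Suc n)) < e" using reals_Archimedean[OF e] ..
    define \<beta> where "\<beta> = \<alpha>(0 := max (\<alpha> 0) n)"
    have "K \<alpha> \<subseteq> K \<beta>" by (rule mono) (simp add: \<beta>_def le_fun_def)
    moreover have "inverse (real (Suc (\<beta> 0))) \<le> inverse (real (Suc n))" by (simp add: \<beta>_def)
    moreover have "\<bar>f z\<bar> \<le> inverse (real (Suc (\<beta> 0)))" if "f \<in> U \<beta>" "z \<in> K \<beta>" for f z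
      using that by (auto simp: U_def)
    ultimately have "\<bar>f z\<bar> < e" if "f \<in> U \<beta>" "z \<in> C" for f z
      using that \<alpha> n by (meson le_less_trans subsetD)
    then have "U \<beta> \<subseteq> N" using CN by (auto simp: U_def)
    then show ?thesis by blast
  qed
  ultimately show ?thesis unfolding G_base_def by (intro exI[of _ U]) blast
qed

text \<open>By compactness finitely many points of X distinguish \<open>f\<close> from every member
  of \<open>K\<close>. The sum of squared differences at these points is 0 at \<open>f\<close> and
  bounded below by some \<open>c > 0\<close> on \<open>K\<close>, so a truncated affine function of
  it separates. The value 2 is chosen to violate a polar bound of 1.\<close>

lemma Ck_separate_compact_point:
  assumes K: "compactin (Ck X) K" and f: "f \<in> Ck_carrier X" "f \<notin> K"
  obtains F where "F \<in> Ck_carrier (Ck X)" "\<And>g. g \<in> K \<Longrightarrow> F g = 0" "F f = 2"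
proof -
  have KC: "K \<subseteq> Ck_carrier X" using compactin_subset_topspace[OF K] by simp
  define V where "V = (\<lambda>x. {g \<in> Ck_carrier X. g x \<in> - {f x}})"
  have V: "openin (Ck X) (V x)" if "x \<in> topspace X" for x
    using openin_continuous_map_preimage[OF continuous_map_Ck_eval[OF that], of "- {f x}"]
    by (simp add: V_def open_Compl)
  have cover: "K \<subseteq> \<Union>(V ` topspace X)"
  proof
    fix g assume g: "g \<in> K"
    then obtain x where x: "g x \<noteq> f x" using f(2) by (metis ext)
    moreover have "x \<in> topspace X"
    proof (rule ccontr)
      assume "x \<notin> topspace X"
      moreover have "g \<in> Ck_carrier X" using g KC by blast
      ultimately show False using x f(1) by (simp add: Ck_carrier_def)
    qed
    ultimately show "g \<in> \<Union>(V ` topspace X)" using g KC by (auto simp: V_def)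
  qed
  have "\<exists>\<F>. finite \<F> \<and> \<F> \<subseteq> V ` topspace X \<and> K \<subseteq> \<Union>\<F>"
    by (rule compactinD[OF K _ cover]) (use V in auto)
  then obtain A where A: "finite A" "A \<subseteq> topspace X" "K \<subseteq> \<Union>(V ` A)"
    by (metis finite_subset_image)
  define S where "S = (\<lambda>g. \<Sum>x\<in>A. (g x - f x)\<^sup>2)"
  have S: "continuous_map (Ck X) euclideanreal S"
    unfolding S_def using A
    by (intro continuous_map_sum continuous_map_real_pow continuous_map_diff continuous_map_Ck_eval) auto
  have S_pos: "S g > 0" if g: "g \<in> K" for g
  proof -
    obtain x where "x \<in> A" "g x \<noteq> f x" using A(3) g by (auto simp: V_def)
    then show ?thesis unfolding S_def using A(1) by (intro sum_pos2[of _ x]) auto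
  qed
  obtain c where c: "c > 0" "\<And>g. g \<in> K \<Longrightarrow> c \<le> S g"
  proof (cases "K = {}")
    case True
    then show ?thesis using that[of 1] by simp
  next
    case False
    have "compact (S ` K)" using image_compactin[OF K S] by simp
    then obtain s where "s \<in> S ` K" "\<forall>t\<in>S ` K. s \<le> t"
      using compact_attains_inf[of "S ` K"] False by blast
    then show ?thesis using that[of s] S_pos by auto
  qed
  define F where "F = (\<lambda>g. if g \<in> Ck_carrier X then 2 * max 0 (1 - S g / c) else 0)"
  have "continuous_map (Ck X) euclideanreal (\<lambda>g. 2 * max 0 (1 - S g * inverse c))"
    by (intro continuous_map_real_mult_left continuous_map_real_max continuous_map_diff
        continuous_map_real_mult_right S continuous_map_const[THEN iffD2]) auto
  then have "continuous_map (Ck X) euclideanreal F"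
    by (rule continuous_map_eq) (simp add: F_def divide_inverse)
  then have "F \<in> Ck_carrier (Ck X)" by (simp add: Ck_carrier_def[of "Ck X"]) (simp add: F_def)
  moreover have "F g = 0" if "g \<in> K" for g
    using c(1) c(2)[OF that] by (simp add: F_def max_def field_simps)
  moreover have "F f = 2" using f(1) by (simp add: F_def S_def)
  ultimately show ?thesis using that by blast
qed

text \<open>Polars of the base sets again. If \<open>U \<alpha>\<close> contains the functions small
  on a compact \<open>C\<close>, it contains every function vanishing on \<open>C\<close>; a point
  outside \<open>C\<close> is excluded from \<open>K \<alpha>\<close> by one of these with value 2
  there. So \<open>K \<alpha>\<close> is a closed subset of \<open>C\<close>.\<close>

lemma G_base_Ck_Ck_imp_compact_resolution:
  assumes G: "G_base (Ck (Ck X)) (\<lambda>_. 0)"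
  shows "fundamental_compact_resolution (Ck X)"
proof -
  let ?Z = "Ck X"
  obtain U :: "(nat \<Rightarrow> nat) \<Rightarrow> (('a \<Rightarrow> real) \<Rightarrow> real) set"
    where U: "\<And>\<alpha>. nhd_in (Ck ?Z) (\<lambda>_. 0) (U \<alpha>)"
    and mono: "\<And>\<alpha> \<beta>. \<beta> \<le> \<alpha> \<Longrightarrow> U \<alpha> \<subseteq> U \<beta>"
    and base: "\<And>N. nhd_in (Ck ?Z) (\<lambda>_. 0) N \<Longrightarrow> \<exists>\<alpha>. U \<alpha> \<subseteq> N"
    using G unfolding G_base_def by metis
  define K where "K = (\<lambda>\<alpha>. {z \<in> Ck_carrier X. \<forall>F\<in>U \<alpha>. \<bar>F z\<bar> \<le> 1})"
  have K: "compactin ?Z (K \<alpha>)" for \<alpha>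
  proof -
    obtain C e where C: "compactin ?Z C" and e: "e > 0"
      and CU: "{F \<in> Ck_carrier ?Z. \<forall>z\<in>C. \<bar>F z\<bar> < e} \<subseteq> U \<alpha>"
      using U[of \<alpha>] unfolding nhd_in_Ck_zero_iff by blast
    have "K \<alpha> \<subseteq> C"
    proof
      fix z assume z: "z \<in> K \<alpha>"
      show "z \<in> C"
      proof (rule ccontr)
        assume "z \<notin> C"
        then obtain F where F: "F \<in> Ck_carrier ?Z" "\<And>g. g \<in> C \<Longrightarrow> F g = 0" "F z = 2"
          using Ck_separate_compact_point[OF C, of z] z by (auto simp: K_def)
        then have "F \<in> U \<alpha>" using CU e by auto
        then show False using z F(3) by (auto simp: K_def)
      qed
    qed
    moreover have "closedin ?Z (K \<alpha>)"
    proof -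
      have UC: "U \<alpha> \<subseteq> Ck_carrier ?Z" and U0: "U \<alpha> \<noteq> {}" using U[of \<alpha>] by (auto simp: nhd_in_def)
      have "closedin ?Z {z \<in> topspace ?Z. F z \<in> {-1..1}}" if "F \<in> U \<alpha>" for F
        using that UC by (intro closedin_continuous_map_preimage[OF Ck_carrier_continuous]) auto
      then have "closedin ?Z (\<Inter>F\<in>U \<alpha>. {z \<in> topspace ?Z. F z \<in> {-1..1}})"
        using U0 by (intro closedin_Inter) auto
      also have "(\<Inter>F\<in>U \<alpha>. {z \<in> topspace ?Z. F z \<in> {-1..1}}) = K \<alpha>"
        using U0 by (auto simp: K_def abs_le_iff)
      finally show ?thesis .
    qed
    ultimately show ?thesis by (rule closed_compactin[OF C])
  qed
  have swallow: "\<exists>\<alpha>. C \<subseteq> K \<alpha>" if C: "compactin ?Z C" for C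
  proof -
    have "nhd_in (Ck ?Z) (\<lambda>_. 0) {F \<in> Ck_carrier ?Z. \<forall>z\<in>C. \<bar>F z\<bar> < 1}"
      unfolding nhd_in_Ck_zero_iff using C by (intro conjI exI[of _ C] exI[of _ 1]) auto
    then obtain \<alpha> where "U \<alpha> \<subseteq> {F \<in> Ck_carrier ?Z. \<forall>z\<in>C. \<bar>F z\<bar> < 1}" using base by blast
    then have "C \<subseteq> K \<alpha>"
      using compactin_subset_topspace[OF C] by (auto simp: K_def less_imp_le)
    then show ?thesis by blast
  qed
  have "(\<Union>\<alpha>. K \<alpha>) = topspace ?Z"
  proof
    show "(\<Union>\<alpha>. K \<alpha>) \<subseteq> topspace ?Z" by (auto simp: K_def)
    show "topspace ?Z \<subseteq> (\<Union>\<alpha>. K \<alpha>)"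
    proof
      fix f assume "f \<in> topspace ?Z"
      then have "compactin ?Z {f}" by simp
      from swallow[OF this] show "f \<in> (\<Union>\<alpha>. K \<alpha>)" by auto
    qed
  qed
  moreover have "K \<alpha> \<subseteq> K \<beta>" if "\<alpha> \<le> \<beta>" for \<alpha> \<beta>
    using mono[OF that] by (auto simp: K_def)
  ultimately show ?thesis
    unfolding fundamental_compact_resolution_def using K swallow by (intro exI[of _ K]) blast
qed

section \<open>Metrizability of compact subsets\<close>

text \<open>If the union were uncountable, one could follow a branch \<alpha> along which the sets
  with indices agreeing with \<alpha> up to \<open>n\<close> always have uncountable union. Choosing
  \<open>n\<close> points at stage \<open>n\<close> and bounding all their indices by one \<gamma>
  would put arbitrarily many points into the finite set \<open>D \<gamma>\<close>.\<close>

lemma countable_Union_finite_resolution: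
  fixes D :: "(nat \<Rightarrow> nat) \<Rightarrow> 'b set"
  assumes mono: "\<And>\<alpha> \<beta>. \<alpha> \<le> \<beta> \<Longrightarrow> D \<alpha> \<subseteq> D \<beta>" and fin: "\<And>\<alpha>. finite (D \<alpha>)"
  shows "countable (\<Union>\<alpha>. D \<alpha>)"
proof (rule ccontr)
  assume unc: "uncountable (\<Union>\<alpha>. D \<alpha>)"
  define C where "C = (\<lambda>n \<alpha>. \<Union>\<beta>\<in>{\<beta>. \<forall>i<n. \<beta> i = \<alpha> i}. D \<beta>)"
  have cong: "C n \<alpha> = C n \<beta>" if "\<forall>i<n. \<alpha> i = \<beta> i" for n \<alpha> \<beta>
    using that by (simp add: C_def)
  have "\<exists>g. \<forall>n. uncountable (C n (g n)) \<and> (\<forall>i<n. g (Suc n) i = g n i)"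
  proof (rule dependent_nat_choice)
    show "\<exists>\<alpha>. uncountable (C 0 \<alpha>)" using unc by (simp add: C_def)
    fix \<alpha> n assume n: "uncountable (C n \<alpha>)"
    \<comment> \<open>The next entry has only countably many values, so one of the resulting pieces
      remains uncountable.\<close>
    have "C n \<alpha> \<subseteq> (\<Union>k. C (Suc n) (\<alpha>(n := k)))"
    proof
      fix x assume "x \<in> C n \<alpha>"
      then obtain \<beta> where "\<forall>i<n. \<beta> i = \<alpha> i" "x \<in> D \<beta>" by (auto simp: C_def)
      then have "x \<in> C (Suc n) (\<alpha>(n := \<beta> n))" by (auto simp: C_def less_Suc_eq)
      then show "x \<in> (\<Union>k. C (Suc n) (\<alpha>(n := k)))" by blast
    qed
    with n have "uncountable (\<Union>k. C (Suc n) (\<alpha>(n := k)))" using countable_subset by blast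
    then obtain k where "uncountable (C (Suc n) (\<alpha>(n := k)))" by auto
    then show "\<exists>\<beta>. uncountable (C (Suc n) \<beta>) \<and> (\<forall>i<n. \<beta> i = \<alpha> i)"
      by (intro exI[of _ "\<alpha>(n := k)"]) simp
  qed
  then obtain g where g: "\<And>n. uncountable (C n (g n))" and gS: "\<And>n i. i < n \<Longrightarrow> g (Suc n) i = g n i"
    by blast
  \<comment> \<open>Entry \<open>i\<close> is first fixed at stage \<open>Suc i\<close> and never
    changes afterwards.\<close>
  define \<alpha> where "\<alpha> = (\<lambda>i. g (Suc i) i)"
  have "g n i = \<alpha> i" if "i < n" for n i
    using that
  proof (induction n)
    case (Suc n)
    then show ?case using gS by (cases "i = n") (auto simp: \<alpha>_def)
  qed simp
  then have "C n (g n) = C n \<alpha>" for n by (intro cong) simp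
  with g have "infinite (C n \<alpha>)" for n by (metis countable_finite)
  \<comment> \<open>Only finitely many points are taken at each stage, so that their indices can be
    bounded, but the number grows with \<open>n\<close>.\<close>
  then have "\<exists>B. finite B \<and> card B = n \<and> B \<subseteq> C n \<alpha>" for n
    by (rule infinite_arbitrarily_large)
  then obtain B where B: "\<And>n. finite (B n)" "\<And>n. card (B n) = n" "\<And>n. B n \<subseteq> C n \<alpha>"
    by metis
  define b where "b = (\<lambda>n x. SOME \<beta>. (\<forall>i<n. \<beta> i = \<alpha> i) \<and> x \<in> D \<beta>)"
  have b: "(\<forall>i<n. b n x i = \<alpha> i) \<and> x \<in> D (b n x)" if "x \<in> B n" for n x
  proof -
    have "\<exists>\<beta>. (\<forall>i<n. \<beta> i = \<alpha> i) \<and> x \<in> D \<beta>" using that B(3)[of n] by (auto simp: C_def)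
    from someI_ex[OF this] show ?thesis by (simp add: b_def)
  qed
  \<comment> \<open>only the finitely many \<open>b n x\<close> with \<open>n \<le> i\<close> can differ from \<open>\<alpha>\<close> at \<open>i\<close>, so all of them
     have a common upper bound\<close>
  define S where "S = (\<lambda>i. insert (\<alpha> i) (\<Union>n\<le>i. (\<lambda>x. b n x i) ` B n))"
  define \<gamma> where "\<gamma> = (\<lambda>i. Max (S i))"
  have S: "finite (S i)" for i using B(1) by (auto simp: S_def)
  have "b n x \<le> \<gamma>" if x: "x \<in> B n" for n x
    unfolding le_fun_def
  proof
    fix i
    have "b n x i \<in> S i"
      using b[OF x] x by (cases "i < n") (auto simp: S_def)
    then show "b n x i \<le> \<gamma> i" using S by (simp add: \<gamma>_def)
  qed
  then have "B n \<subseteq> D \<gamma>" for n using b mono by blast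
  then have "n \<le> card (D \<gamma>)" for n using card_mono[OF fin] B(2) by metis
  from this[of "Suc (card (D \<gamma>))"] show False by simp
qed

text \<open>Two functions within \<open>e/2\<close> of a common one on \<open>K\<close> cannot be
  \<open>e\<close>-separated there, so each set of a finite cover of \<open>C\<close> by such
  neighbourhoods meets \<open>S\<close> in at most one function.\<close>

lemma finite_separated_subset_compact:
  assumes C: "compactin (Ck X) C" and K: "compactin X K" and e: "e > 0" and S: "S \<subseteq> C"
    and sep: "\<And>f g. f \<in> S \<Longrightarrow> g \<in> S \<Longrightarrow> f \<noteq> g \<Longrightarrow> \<exists>x\<in>K. e \<le> \<bar>f x - g x\<bar>"
  shows "finite S"
proof -
  have CC: "C \<subseteq> Ck_carrier X" using compactin_subset_topspace[OF C] by simp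
  have "\<exists>V. openin (Ck X) V \<and> f \<in> V \<and> V \<subseteq> {g \<in> Ck_carrier X. \<forall>x\<in>K. \<bar>g x - f x\<bar> < e/2}"
    if "f \<in> C" for f
    using Ck_ball_neighbourhood[OF _ K half_gt_zero[OF e]] that CC by blast
  then obtain V where V: "\<And>f. f \<in> C \<Longrightarrow> openin (Ck X) (V f)" "\<And>f. f \<in> C \<Longrightarrow> f \<in> V f"
    and VK: "\<And>f g x. f \<in> C \<Longrightarrow> g \<in> V f \<Longrightarrow> x \<in> K \<Longrightarrow> \<bar>g x - f x\<bar> < e/2"
    by (simp add: subset_iff) metis
  have "\<exists>\<F>. finite \<F> \<and> \<F> \<subseteq> V ` C \<and> C \<subseteq> \<Union>\<F>"
    by (rule compactinD[OF C]) (use V in auto)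
  then obtain A where A: "finite A" "A \<subseteq> C" "C \<subseteq> \<Union>(V ` A)"
    by (metis finite_subset_image)
  have "finite (S \<inter> V f)" if f: "f \<in> A" for f
  proof -
    have "g = h" if gh: "g \<in> S \<inter> V f" "h \<in> S \<inter> V f" for g h
    proof (rule ccontr)
      assume "g \<noteq> h"
      then obtain x where x: "x \<in> K" "e \<le> \<bar>g x - h x\<bar>" using sep gh by blast
      moreover have "\<bar>g x - f x\<bar> < e/2" "\<bar>h x - f x\<bar> < e/2"
        using VK[of f _ x] f A(2) gh x(1) by auto
      ultimately show False by linarith
    qed
    then have "S \<inter> V f = {} \<or> (\<exists>g. S \<inter> V f = {g})" by blast
    then show ?thesis by auto
  qed
  then have "finite (\<Union>f\<in>A. S \<inter> V f)" using A(1) by blast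
  moreover have "S \<subseteq> (\<Union>f\<in>A. S \<inter> V f)" using S A(3) by blast
  ultimately show ?thesis by (rule finite_subset[rotated])
qed

text \<open>A maximal \<open>e\<close>-separated family is an \<open>e\<close>-net. It meets each
  compact set of the resolution in a finite set, so the combinatorial lemma on monotone unions makes
  it countable.\<close>

lemma compact_resolution_imp_countable_net:
  assumes R: "fundamental_compact_resolution (Ck X)" and K: "compactin X K" and e: "e > 0"
  obtains E where "countable E" "E \<subseteq> Ck_carrier X"
    "\<And>f. f \<in> Ck_carrier X \<Longrightarrow> \<exists>g\<in>E. \<forall>x\<in>K. \<bar>g x - f x\<bar> < e"
proof -
  define sep where "sep = {E. E \<subseteq> Ck_carrier X \<and>
    (\<forall>f\<in>E. \<forall>g\<in>E. f \<noteq> g \<longrightarrow> (\<exists>x\<in>K. e \<le> \<bar>f x - g x\<bar>))}"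
  have "\<exists>E\<in>sep. \<forall>F\<in>sep. E \<subseteq> F \<longrightarrow> F = E"
  proof (rule subset_Zorn')
    fix \<C> assume chain: "subset.chain sep \<C>"
    have "\<exists>x\<in>K. e \<le> \<bar>f x - g x\<bar>" if fg: "f \<in> \<Union>\<C>" "g \<in> \<Union>\<C>" "f \<noteq> g" for f g
    proof -
      obtain E where "E \<in> \<C>" "f \<in> E" "g \<in> E"
        using fg chain unfolding subset.chain_def by blast
      then show ?thesis using fg(3) chain unfolding subset.chain_def sep_def by blast
    qed
    moreover have "\<Union>\<C> \<subseteq> Ck_carrier X"
      using chain unfolding subset.chain_def sep_def by blast
    ultimately show "\<Union>\<C> \<in> sep" by (simp add: sep_def)
  qed
  then obtain E where E: "E \<in> sep" and max: "\<And>F. F \<in> sep \<Longrightarrow> E \<subseteq> F \<Longrightarrow> F = E" by blast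
  have EC: "E \<subseteq> Ck_carrier X"
    and Es: "\<And>f g. f \<in> E \<Longrightarrow> g \<in> E \<Longrightarrow> f \<noteq> g \<Longrightarrow> \<exists>x\<in>K. e \<le> \<bar>f x - g x\<bar>"
    using E by (auto simp: sep_def)
  obtain C :: "(nat \<Rightarrow> nat) \<Rightarrow> ('a \<Rightarrow> real) set" where C: "\<And>\<alpha>. compactin (Ck X) (C \<alpha>)"
    and cover: "(\<Union>\<alpha>. C \<alpha>) = Ck_carrier X" and mono: "\<And>\<alpha> \<beta>. \<alpha> \<le> \<beta> \<Longrightarrow> C \<alpha> \<subseteq> C \<beta>"
    using R unfolding fundamental_compact_resolution_def topspace_Ck by metis
  have "countable (\<Union>\<alpha>. E \<inter> C \<alpha>)"
  proof (rule countable_Union_finite_resolution)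
    show "E \<inter> C \<alpha> \<subseteq> E \<inter> C \<beta>" if "\<alpha> \<le> \<beta>" for \<alpha> \<beta> using mono[OF that] by blast
    show "finite (E \<inter> C \<alpha>)" for \<alpha>
      by (rule finite_separated_subset_compact[OF C K e]) (auto intro: Es)
  qed
  also have "(\<Union>\<alpha>. E \<inter> C \<alpha>) = E" using EC cover by blast
  finally have "countable E" .
  moreover have "\<exists>g\<in>E. \<forall>x\<in>K. \<bar>g x - f x\<bar> < e" if f: "f \<in> Ck_carrier X" for f
  proof (rule ccontr)
    assume "\<not> ?thesis"
    then have far: "\<exists>x\<in>K. e \<le> \<bar>g x - f x\<bar>" if "g \<in> E" for g using that by force
    then have far': "\<exists>x\<in>K. e \<le> \<bar>f x - g x\<bar>" if "g \<in> E" for g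
      using far[OF that] by (simp add: abs_minus_commute)
    \<comment> \<open>A function far from all of \<open>E\<close> could be added, so by maximality
      it already lies in \<open>E\<close>; but then it would be far from itself.\<close>
    have "insert f E \<in> sep" using E f far far' by (auto simp: sep_def)
    then have "f \<in> E" using max[of "insert f E"] by blast
    then show False using far[of f] e by simp
  qed
  ultimately show ?thesis using EC that by blast
qed

lemma Ck_separates_points:
  assumes X: "completely_regular_space X" "Hausdorff_space X"
    and xy: "x \<in> topspace X" "y \<in> topspace X" "x \<noteq> y"
  obtains f where "f \<in> Ck_carrier X" "f x = 0" "f y = 1"
proof -
  have "closedin X {y}" using closedin_Hausdorff_singleton[OF X(2) xy(2)] .
  then obtain f where f: "continuous_map X euclideanreal f" "f x = 0" "f ` {y} \<subseteq> {1}"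
    using X(1) xy unfolding completely_regular_space_alt by (metis DiffI singletonD)
  define h where "h = (\<lambda>z. if z \<in> topspace X then f z else 0)"
  have "continuous_map X euclideanreal h"
    by (rule continuous_map_eq[OF f(1)]) (simp add: h_def)
  then have "h \<in> Ck_carrier X" by (simp add: Ck_carrier_def) (simp add: h_def)
  then show ?thesis using that[of h] f(2,3) xy by (simp add: h_def)
qed

text \<open>Evaluation at the members of \<open>E\<close> maps \<open>K\<close> continuously and
  injectively into a countable power of the reals. From a compact space to a Hausdorff one this is
  an embedding, and the power is metrizable.\<close>

lemma metrizable_compact_if_countable_separating:
  assumes K: "compactin X K" and E: "countable E" "\<And>f. f \<in> E \<Longrightarrow> continuous_map X euclideanreal f"
    and sep: "\<And>x y. x \<in> K \<Longrightarrow> y \<in> K \<Longrightarrow> x \<noteq> y \<Longrightarrow> \<exists>f\<in>E. f x \<noteq> f y"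
  shows "metrizable_space (subtopology X K)"
proof -
  let ?P = "product_topology (\<lambda>_. euclideanreal) E"
  define \<phi> where "\<phi> = (\<lambda>x. restrict (\<lambda>f. f x) E)"
  have top: "topspace (subtopology X K) = K" using compactin_subset_topspace[OF K] by auto
  have "continuous_map (subtopology X K) ?P \<phi>"
    unfolding continuous_map_componentwise using E(2)
    by (auto simp: \<phi>_def intro!: continuous_map_from_subtopology)
  moreover have "inj_on \<phi> K"
  proof (rule inj_onI, rule ccontr)
    fix x y assume xy: "x \<in> K" "y \<in> K" "\<phi> x = \<phi> y" "x \<noteq> y"
    then obtain f where "f \<in> E" "f x \<noteq> f y" using sep by blast
    then show False using fun_cong[OF xy(3), of f] by (simp add: \<phi>_def)
  qed
  moreover have "Hausdorff_space ?P" by (simp add: Hausdorff_space_product_topology)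
  ultimately have "embedding_map (subtopology X K) ?P \<phi>"
    using compact_space_subtopology[OF K] top by (intro continuous_imp_embedding_map) auto
  then have "subtopology X K homeomorphic_space subtopology ?P (\<phi> ` topspace (subtopology X K))"
    by (rule embedding_map_imp_homeomorphic_space)
  moreover have "metrizable_space ?P"
    by (rule metrizable_topology_D)
      (use E(1) in \<open>auto simp: PiE_eq_empty_iff metrizable_space_euclidean intro: countable_subset\<close>)
  ultimately show ?thesis
    using homeomorphic_metrizable_space metrizable_space_subtopology by blast
qed

text \<open>If \<open>f\<close> takes the values 0 and 1 at two points, any function within 1/2 of
  it at both takes different values there. Hence a countable net of that mesh separates the points
  of \<open>K\<close>.\<close>

lemma compact_resolution_imp_metrizable:
  assumes X: "completely_regular_space X" "Hausdorff_space X"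
    and R: "fundamental_compact_resolution (Ck X)" and K: "compactin X K"
  shows "metrizable_space (subtopology X K)"
proof -
  obtain E where E: "countable E" "E \<subseteq> Ck_carrier X"
    "\<And>f. f \<in> Ck_carrier X \<Longrightarrow> \<exists>g\<in>E. \<forall>x\<in>K. \<bar>g x - f x\<bar> < 1/2"
    by (rule compact_resolution_imp_countable_net[OF R K, of "1/2"]) (simp, rule that)
  have "\<exists>g\<in>E. g x \<noteq> g y" if xy: "x \<in> K" "y \<in> K" "x \<noteq> y" for x y
  proof -
    have "x \<in> topspace X" "y \<in> topspace X" using xy compactin_subset_topspace[OF K] by auto
    then obtain f where f: "f \<in> Ck_carrier X" "f x = 0" "f y = 1"
      using Ck_separates_points[OF X] xy(3) by metis
    obtain g where g: "g \<in> E" "\<forall>x\<in>K. \<bar>g x - f x\<bar> < 1/2" using E(3)[OF f(1)] by blast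
    then have "\<bar>g x\<bar> < 1/2" "\<bar>g y - 1\<bar> < 1/2" using f(2,3) xy by force+
    then have "g x \<noteq> g y" by linarith
    then show ?thesis using g(1) by blast
  qed
  moreover have "continuous_map X euclideanreal f" if "f \<in> E" for f
    using E(2) that by (auto intro: Ck_carrier_continuous)
  ultimately show ?thesis
    by (intro metrizable_compact_if_countable_separating[OF K E(1)])
qed

text \<open>Metrizability is stated under the first condition and transfers to the other two by the
  equivalences.\<close>

theorem theorem3p6:
  fixes X :: "'a topology"
  assumes "completely_regular_space X" and "Hausdorff_space X"
    and "ascoli_space X"
  shows "(G_base (Lfree X) (\<lambda>_. 0) \<longleftrightarrow> fundamental_compact_resolution (Ck X))
       \<and> (fundamental_compact_resolution (Ck X) \<longleftrightarrow> G_base (Ck (Ck X)) (\<lambda>_. 0))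
       \<and> (G_base (Lfree X) (\<lambda>_. 0) \<longrightarrow>
            (\<forall>K. compactin X K \<longrightarrow> metrizable_space (subtopology X K)))"
proof (intro conjI impI allI)
  show *: "G_base (Lfree X) (\<lambda>_. 0) \<longleftrightarrow> fundamental_compact_resolution (Ck X)"
    by (rule iffI[OF G_base_Lfree_imp_compact_resolution[OF assms(3)]
          compact_resolution_imp_G_base_Lfree[OF assms(3)]])
  show "fundamental_compact_resolution (Ck X) \<longleftrightarrow> G_base (Ck (Ck X)) (\<lambda>_. 0)"
    by (rule iffI[OF compact_resolution_imp_G_base_Ck G_base_Ck_Ck_imp_compact_resolution])
  show "metrizable_space (subtopology X K)" if "G_base (Lfree X) (\<lambda>_. 0)" "compactin X K" for K
    using compact_resolution_imp_metrizable[OF assms(1,2) _ that(2)] that(1) * by simp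
qed

end
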